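(* Consider the control-affine system without stochastic perturbation, $\dot x=f(x,t)+B(x,t)u+d(x,t)$, and write $h(x,u,t)=f(x,t)+B(x,t)u$. Let $u_L(x,x_d,u_d,t)=u_L(x,x_d,u_d,t;\theta_u)$ be the neural-network controller that models a contracting control law $u^*$ (as described in the context) and that is learned, jointly with the dual metric $W_L(x,t;\theta_w)$, by minimizing the empirical loss $\mathcal{L}(\theta_u,\theta_w)$ defined in the context. Suppose that the following hold for $u_L$: (A1) for all $(x,x_d,u_d,t)\in S=S_x\times S_x\times S_u\times S_t$, $\|u_L(x,x_d,u_d,t)-u^*(x,x_d,u_d,t)\|\le\epsilon_{\ell0}+\epsilon_{\ell1}\int_{x_d}^{x}\|\delta q\|$, where $S_x\subset\mathbb{R}^n$, $S_u\subset\mathbb{R}^m$, $S_t\subset\mathbb{R}_+$ are given compact sets; (A2) $h$ is Lipschitz in $u$: there is $L_u\in[0,\infty)$ with $\|h(x,u,t)-h(x,u',t)\|\le L_u\|u-u'\|$ for all $u,u'\in\mathbb{R}^m$ and all $x\in S_x$, $t\in S_t$. If the system is controlled by $u=u_L$, then $$\|x(t)-x_d(t)\|\le\frac{\|V_\ell(0)\|}{\sqrt{\underline m}}e^{-\alpha_\ell t}+\frac{L_u\epsilon_{\ell0}+\bar d}{\alpha_\ell}\sqrt{\frac{\overline m}{\underline m}}\left(1-e^{-\alpha_\ell t}\right),$$ where $\alpha_\ell=\alpha-L_u\epsilon_{\ell1}\sqrt{\overline m/\underline m}$ and $V_\ell(t)=\int_{x_d}^{x}\|\Theta(q(t),t)\,\delta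 q(t)\|$; that is, the distance between the target trajectory $x_d$ and the perturbed trajectories $x$ is exponentially bounded.
   Context: Notation: $\|\cdot\|$ is the Euclidean/induced 2-norm, $\|\cdot\|_F$ the Frobenius norm, $\mathrm{sym}(A)=(A+A^{\top})/2$, $\delta x$ an infinitesimal displacement at fixed time; for $p(x,t)\in\mathbb{R}^n$ and $F(x,t)\in\mathbb{R}^{n\times n}$, $\partial_pF=\sum_{k=1}^n(\partial F/\partial x_k)p_k$. System: $t\in\mathbb{R}_+$, $x(t)\in\mathbb{R}^n$, $u\in\mathbb{R}^m$; $f:\mathbb{R}^n\times\mathbb{R}_+\to\mathbb{R}^n$ and $B:\mathbb{R}^n\times\mathbb{R}_+\to\mathbb{R}^{n\times m}$ are known smooth functions; $d$ is an unknown bounded function with $\sup_{x,t}\|d(x,t)\|=\bar d$. Contracting control law: $u^*$ is a feedback law $u^*(x,x_d,u_d,t)$ with a uniformly positive definite contraction metric $M(x,t)=\Theta(x,t)^{\top}\Theta(x,t)$ satisfying $\dot M+2\,\mathrm{sym}\left(M\,\partial h(x,u^*(x,x_d,u_d,t),t)/\partial x\right)+2\alpha M\preceq0$ for all $x,t$, where $\alpha\in(0,\infty)$ is the contraction rate; $\underline m,\overline m\in(0,\infty)$ denote the constants in the bound $\underline mI\preceq M(x,t)\preceq\overline mI$ on the metric. Here $\partial h/\partial x$ is the total derivative in $x$, including the dependence of the feedback law on $x$. The target trajectory is given by $\dot x_d=h(x_d,u_d,t)$ with $u_d=u^*(x_d,x_d,u_d,t)$. Virtual system: $\dot q=h(q,u^*(q,x_d,u_d,t),t)+d_q(q,t)$,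 which has $q=x$ and $q=x_d$ as particular solutions, where $d_q$ is parameterized linearly so that $d_q=0$ at $q=x_d$ and $d_q=h(x,u_L(x,x_d,u_d,t),t)-h(x,u^*(x,x_d,u_d,t),t)+d(x,t)$ at $q=x$. The integrals $\int_{x_d}^{x}\|\delta q\|$ and $\int_{x_d}^{x}\|\Theta\,\delta q\|$ are path integrals from $x_d$ to $x$ along the path parameterized by $q$. Training: the dual metric is $W_L(x,t;\theta_w)=\Theta_L(x,t;\theta_\vartheta)^{\top}\Theta_L(x,t;\theta_\vartheta)+\overline m_L^{-1}I$, with $\Theta_L$ a neural network and $\theta_w$ consisting of $\theta_\vartheta$, $\overline m_L>0$ and $\underline m_L$; it models $W=M^{-1}$. The empirical loss is $$\mathcal{L}(\theta_u,\theta_w)=\frac1N\sum_{i=1}^N\left(\mathcal{L}_{m,i}+\mathcal{L}_{w,i}\right),$$ $$\mathcal{L}_{m,i}=L_{PD}(-C_u(\xi_i;\theta_w,\theta_u))+L_{PD}(\underline m_L^{-1}I-W_L(x_i,t_i;\theta_w)),\quad\mathcal{L}_{w,i}=L_{PD}(-C_1(x_i,t_i;\theta_w))+\sum_{j=1}^m\|C_2^j(x_i,t_i;\theta_w)\|_F,$$ where the samples $\xi_i=(x_i,x_{d,i},u_{d,i},t_i)$, $i=1,\dots,N$, are drawn independently from the uniform distribution on $S$; $C_u=\dot M+2\,\mathrm{sym}(M\,\partial h/\partial x)+2\alpha M$ evaluated with $M=W_L^{-1}$ and $u=u_L$; $C_1=B_\perp^{\top}\left(-\frac{\partial W}{\partial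 t}-\partial_fW+2\,\mathrm{sym}(\frac{\partial f}{\partial x}W)+2\alpha W\right)B_\perp$ and $C_2^j=B_\perp^{\top}\left(\partial_{b_j}W-2\,\mathrm{sym}(\frac{\partial b_j}{\partial x}W)\right)B_\perp$ evaluated with $W=W_L$; $b_j$ is the $j$th column of $B$, and $B_\perp(x,t)$ is an annihilator matrix of $B$, $B_\perp^{\top}B=0$. $L_{PD}\ge0$ penalizes non-positive definiteness ($L_{PD}(A)=0$ iff $A\succeq0$) and is computed as $L_{PD}(A)=\frac1K\sum_{i=1}^K\max\{0,-p_i^{\top}Ap_i\}$ for $K$ randomly sampled unit vectors $p_i\in\mathbb{R}^n$.
   Formalization: The bound is stated for t in [0,T] with (x(t),x_d(t),u_d(t),t) in S throughout, since (A1) and (A2) say nothing outside the compact S; α_ℓ ≠ 0 is required; (A1) is read as holding for the length of every C¹ path from x_d to x; the law and metric are taken C¹. *)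

theory Defs
  imports "HOL-Analysis.Analysis" "HOL-Probability.Probability"
begin

text \<open>On the sets used below (\<open>UNIV\<close>, \<open>UNIV \<times> {0..}\<close> and \<open>{0..1}\<close>) the derivative
  within the set is unique, so this is the usual \<open>C\<^sup>k\<close> up to the boundary.\<close>

primrec Ck_on ::
  "nat \<Rightarrow> 'a::real_normed_vector set \<Rightarrow> ('a \<Rightarrow> 'b::real_normed_vector) \<Rightarrow> bool" where
  "Ck_on 0 U f = continuous_on U f"
| "Ck_on (Suc k) U f =
     (\<exists>f'. (\<forall>x\<in>U. (f has_derivative f' x) (at x within U)) \<and> (\<forall>v. Ck_on k U (\<lambda>x. f' x v)))"

definition smooth_on :: "'a::real_normed_vector set \<Rightarrow> ('a \<Rightarrow> 'b::real_normed_vector) \<Rightarrow> bool" where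
  "smooth_on U f \<longleftrightarrow> (\<forall>k. Ck_on k U f)"

definition psd :: "real^'n^'n \<Rightarrow> bool" where
  "psd A \<longleftrightarrow> transpose A = A \<and> (\<forall>v. 0 \<le> v \<bullet> (A *v v))"

definition loewner_le :: "real^'n^'n \<Rightarrow> real^'n^'n \<Rightarrow> bool" (infix "\<preceq>" 50) where
  "A \<preceq> C \<longleftrightarrow> psd (C - A)"

definition msym :: "real^'n^'n \<Rightarrow> real^'n^'n" where
  "msym A = (1/2) *\<^sub>R (A + transpose A)"

text \<open>Time ranges over \<open>{0..}\<close>; the time derivative is one-sided at \<open>0\<close>.\<close>

definition dt_mat :: "(real^'n \<Rightarrow> real \<Rightarrow> real^'n^'n) \<Rightarrow> real^'n \<Rightarrow> real \<Rightarrow> real^'n^'n" where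
  "dt_mat F x t = vector_derivative (\<lambda>s. F x s) (at t within {0..})"

definition dir_mat :: "real^'n \<Rightarrow> (real^'n \<Rightarrow> real \<Rightarrow> real^'n^'n) \<Rightarrow> real^'n \<Rightarrow> real \<Rightarrow> real^'n^'n" where
  "dir_mat p F x t =
     (\<Sum>k\<in>UNIV. p $ k *\<^sub>R vector_derivative (\<lambda>s. F (x + s *\<^sub>R axis k 1) t) (at 0))"

definition ctrl_affine ::
  "(real^'n \<Rightarrow> real \<Rightarrow> real^'n) \<Rightarrow> (real^'n \<Rightarrow> real \<Rightarrow> real^'m^'n)
    \<Rightarrow> real^'n \<Rightarrow> real^'m \<Rightarrow> real \<Rightarrow> real^'n" where
  "ctrl_affine f B x u t = f x t + B x t *v u"

text \<open>The matrix \<open>dM/dt + 2 sym(M \<partial>h/\<partial>x) + 2 \<alpha> M\<close> at \<open>(x, t)\<close> under the state feedback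
  \<open>u = \<kappa>(x)\<close>. Here \<open>dM/dt\<close> is the total derivative along \<open>dx/dt = h(x, \<kappa>(x), t)\<close>, and
  \<open>\<partial>h/\<partial>x\<close> includes the dependence of \<open>\<kappa>\<close> on \<open>x\<close>.\<close>

definition contraction_mat ::
  "(real^'n \<Rightarrow> real^'m \<Rightarrow> real \<Rightarrow> real^'n) \<Rightarrow> (real^'n \<Rightarrow> real \<Rightarrow> real^'n^'n) \<Rightarrow> real
    \<Rightarrow> (real^'n \<Rightarrow> real^'m) \<Rightarrow> real^'n \<Rightarrow> real \<Rightarrow> real^'n^'n" where
  "contraction_mat h M \<alpha> \<kappa> x t =
     dt_mat M x t + dir_mat (h x (\<kappa> x) t) M x t
     + 2 *\<^sub>R msym (M x t ** jacobian (\<lambda>y. h y (\<kappa> y) t) (at x))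
     + (2 * \<alpha>) *\<^sub>R M x t"

definition metric :: "(real^'n \<Rightarrow> real \<Rightarrow> real^'n^'n) \<Rightarrow> real^'n \<Rightarrow> real \<Rightarrow> real^'n^'n" where
  "metric \<Theta> x t = transpose (\<Theta> x t) ** \<Theta> x t"

definition target_trajectory ::
  "(real^'n \<Rightarrow> real^'m \<Rightarrow> real \<Rightarrow> real^'n)
    \<Rightarrow> (real^'n \<Rightarrow> real^'n \<Rightarrow> real^'m \<Rightarrow> real \<Rightarrow> real^'m)
    \<Rightarrow> (real \<Rightarrow> real^'n) \<Rightarrow> (real \<Rightarrow> real^'m) \<Rightarrow> bool" where
  "target_trajectory h us xd ud \<longleftrightarrow>
     (\<forall>t\<ge>0. (xd has_vector_derivative h (xd t) (ud t) t) (at t within {0..})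
           \<and> ud t = us (xd t) (xd t) (ud t) t)"

text \<open>The feedback law is contracting along the given target \<open>(xd, ud)\<close>: the state ranges over
  the whole space and the time over \<open>{0..}\<close>.\<close>

definition contracting_law ::
  "(real^'n \<Rightarrow> real^'m \<Rightarrow> real \<Rightarrow> real^'n)
    \<Rightarrow> (real^'n \<Rightarrow> real^'n \<Rightarrow> real^'m \<Rightarrow> real \<Rightarrow> real^'m)
    \<Rightarrow> (real^'n \<Rightarrow> real \<Rightarrow> real^'n^'n) \<Rightarrow> real \<Rightarrow> real \<Rightarrow> real
    \<Rightarrow> (real \<Rightarrow> real^'n) \<Rightarrow> (real \<Rightarrow> real^'m) \<Rightarrow> bool" where
  "contracting_law h us \<Theta> \<alpha> mlow mup xd ud \<longleftrightarrow>
     0 < \<alpha> \<and> 0 < mlow \<and> 0 < mup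
     \<and> Ck_on 1 (UNIV \<times> {0..}) (\<lambda>(x, t). metric \<Theta> x t)
     \<and> (\<forall>t\<ge>0. Ck_on 1 UNIV (\<lambda>x. us x (xd t) (ud t) t))
     \<and> (\<forall>x. \<forall>t\<ge>0. mlow *\<^sub>R mat 1 \<preceq> metric \<Theta> x t \<and> metric \<Theta> x t \<preceq> mup *\<^sub>R mat 1)
     \<and> (\<forall>x. \<forall>t\<ge>0. contraction_mat h (metric \<Theta>) \<alpha> (\<lambda>y. us y (xd t) (ud t) t) x t \<preceq> 0)"

definition C1_path :: "(real \<Rightarrow> real^'n) \<Rightarrow> real^'n \<Rightarrow> real^'n \<Rightarrow> bool" where
  "C1_path \<gamma> a b \<longleftrightarrow> Ck_on 1 {0..1} \<gamma> \<and> pathstart \<gamma> = a \<and> pathfinish \<gamma> = b"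

text \<open>The displacement \<open>\<delta>q\<close> is \<open>(\<partial>q/\<partial>\<mu>) d\<mu>\<close> for the path parameter \<open>\<mu>\<close>;
  \<open>length_int\<close> is the integral of \<open>\<parallel>\<delta>q\<parallel>\<close>, and \<open>weighted_length_int\<close> that of \<open>\<parallel>G(q) \<delta>q\<parallel>\<close>.\<close>

definition length_int :: "(real \<Rightarrow> real^'n) \<Rightarrow> real" where
  "length_int \<gamma> = integral {0..1} (\<lambda>\<mu>. norm (vector_derivative \<gamma> (at \<mu> within {0..1})))"

definition weighted_length_int :: "(real^'n \<Rightarrow> real^'n^'n) \<Rightarrow> (real \<Rightarrow> real^'n) \<Rightarrow> real" where
  "weighted_length_int G \<gamma> =
     integral {0..1} (\<lambda>\<mu>. norm (G (\<gamma> \<mu>) *v vector_derivative \<gamma> (at \<mu> within {0..1})))"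

definition V_ell ::
  "(real^'n \<Rightarrow> real \<Rightarrow> real^'n^'n) \<Rightarrow> (real \<Rightarrow> real \<Rightarrow> real^'n) \<Rightarrow> real \<Rightarrow> real" where
  "V_ell \<Theta> q t = weighted_length_int (\<lambda>y. \<Theta> y t) (\<lambda>\<mu>. q \<mu> t)"

text \<open>A family \<open>q \<mu> t\<close> of virtual trajectories, \<open>\<mu> \<in> {0..1}\<close>, joining \<open>q 0 = xd\<close> to \<open>q 1 = x\<close>.
  The virtual disturbance is linear in \<open>\<mu>\<close>: it is \<open>0\<close> at \<open>\<mu> = 0\<close> and
  \<open>h(x, u\<^sub>L, t) - h(x, u\<^sup>*, t) + d(x, t)\<close> at \<open>\<mu> = 1\<close>.\<close>

definition virtual_family ::
  "(real^'n \<Rightarrow> real^'m \<Rightarrow> real \<Rightarrow> real^'n) \<Rightarrow> (real^'n \<Rightarrow> real \<Rightarrow> real^'n)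
    \<Rightarrow> (real^'n \<Rightarrow> real^'n \<Rightarrow> real^'m \<Rightarrow> real \<Rightarrow> real^'m)
    \<Rightarrow> (real^'n \<Rightarrow> real^'n \<Rightarrow> real^'m \<Rightarrow> real \<Rightarrow> real^'m)
    \<Rightarrow> (real \<Rightarrow> real^'n) \<Rightarrow> (real \<Rightarrow> real^'n) \<Rightarrow> (real \<Rightarrow> real^'m)
    \<Rightarrow> real \<Rightarrow> (real \<Rightarrow> real \<Rightarrow> real^'n) \<Rightarrow> bool" where
  "virtual_family h d us uL x xd ud T q \<longleftrightarrow>
     (\<forall>t\<in>{0..T}. C1_path (\<lambda>\<mu>. q \<mu> t) (xd t) (x t)) \<and>
     (\<forall>\<mu>\<in>{0..1}. \<forall>t\<in>{0..T}.
        (q \<mu> has_vector_derivative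
           h (q \<mu> t) (us (q \<mu> t) (xd t) (ud t) t) t
           + \<mu> *\<^sub>R (h (x t) (uL (x t) (xd t) (ud t) t) t
                    - h (x t) (us (x t) (xd t) (ud t) t) t + d (x t) t))
        (at t within {0..T}))"

text \<open>The neurons are numbered in a topological order of the network graph: neuron \<open>k\<close> applies
  its activation \<open>\<sigma> k\<close> to an affine combination of the network input and of the outputs of the
  earlier neurons. Layered and residual networks, convolutions, weight sharing and weight
  normalization are obtained by restricting the parameters to an admissible set.\<close>

type_synonym 'a nn_param = "(nat \<Rightarrow> 'a) \<times> (nat \<Rightarrow> nat \<Rightarrow> real) \<times> (nat \<Rightarrow> real)"

fun neuron :: "(nat \<Rightarrow> real \<Rightarrow> real) \<Rightarrow> 'a::euclidean_space nn_param \<Rightarrow> 'a \<Rightarrow> nat \<Rightarrow> real" where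
  "neuron \<sigma> (a, w, b) z k =
     \<sigma> k (a k \<bullet> z + (\<Sum>j<k. w k j * neuron \<sigma> (a, w, b) z j) + b k)"

definition nn_controller ::
  "(nat \<Rightarrow> real \<Rightarrow> real) \<Rightarrow> ('m \<Rightarrow> nat) \<Rightarrow> ((real^'n) \<times> (real^'n) \<times> (real^'m) \<times> real) nn_param
    \<Rightarrow> real^'n \<Rightarrow> real^'n \<Rightarrow> real^'m \<Rightarrow> real \<Rightarrow> real^'m" where
  "nn_controller \<sigma> out \<theta> x xd ud t = (\<chi> i. neuron \<sigma> \<theta> (x, xd, ud, t) (out i))"

definition nn_matrix ::
  "(nat \<Rightarrow> real \<Rightarrow> real) \<Rightarrow> ('n \<Rightarrow> 'n \<Rightarrow> nat) \<Rightarrow> ((real^'n) \<times> real) nn_param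
    \<Rightarrow> real^'n \<Rightarrow> real \<Rightarrow> real^'n^'n" where
  "nn_matrix \<sigma> out \<theta> x t = (\<chi> i j. neuron \<sigma> \<theta> (x, t) (out i j))"

text \<open>The parameter of the dual metric is a triple consisting of the network parameter,
  the upper constant and the lower constant of the metric.\<close>

type_synonym 'n metric_param = "((real^'n) \<times> real) nn_param \<times> real \<times> real"

definition W_net ::
  "(nat \<Rightarrow> real \<Rightarrow> real) \<Rightarrow> ('n \<Rightarrow> 'n \<Rightarrow> nat) \<Rightarrow> 'n::finite metric_param
    \<Rightarrow> real^'n \<Rightarrow> real \<Rightarrow> real^'n^'n" where
  "W_net \<sigma> out \<theta>w x t =
     (case \<theta>w of (\<theta>, mup, mlow) \<Rightarrow>
        transpose (nn_matrix \<sigma> out \<theta> x t) ** nn_matrix \<sigma> out \<theta> x t + inverse mup *\<^sub>R mat 1)"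

definition L_PD :: "nat \<Rightarrow> (nat \<Rightarrow> real^'k) \<Rightarrow> real^'k^'k \<Rightarrow> real" where
  "L_PD K p A = (\<Sum>i<K. max 0 (- (p i \<bullet> (A *v p i)))) / real K"

definition C1_mat ::
  "(real^'n \<Rightarrow> real \<Rightarrow> real^'n) \<Rightarrow> (real^'n \<Rightarrow> real \<Rightarrow> real^'k^'n) \<Rightarrow> real
    \<Rightarrow> (real^'n \<Rightarrow> real \<Rightarrow> real^'n^'n) \<Rightarrow> real^'n \<Rightarrow> real \<Rightarrow> real^'k^'k" where
  "C1_mat f Bp \<alpha> W x t =
     transpose (Bp x t)
     ** (- dt_mat W x t - dir_mat (f x t) W x t
         + 2 *\<^sub>R msym (jacobian (\<lambda>y. f y t) (at x) ** W x t) + (2 * \<alpha>) *\<^sub>R W x t)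
     ** Bp x t"

definition C2_mat ::
  "(real^'n \<Rightarrow> real \<Rightarrow> real^'m^'n) \<Rightarrow> (real^'n \<Rightarrow> real \<Rightarrow> real^'k^'n) \<Rightarrow> 'm
    \<Rightarrow> (real^'n \<Rightarrow> real \<Rightarrow> real^'n^'n) \<Rightarrow> real^'n \<Rightarrow> real \<Rightarrow> real^'k^'k" where
  "C2_mat B Bp j W x t =
     transpose (Bp x t)
     ** (dir_mat (column j (B x t)) W x t
         - 2 *\<^sub>R msym (jacobian (\<lambda>y. column j (B y t)) (at x) ** W x t))
     ** Bp x t"

text \<open>The loss as a function of the controller \<open>uL\<close>, the dual metric \<open>W\<close> and the learned
  lower constant \<open>mlow\<close>. The vectors \<open>p\<close> and \<open>p'\<close> are the sampled unit vectors for the two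
  matrix sizes that occur. On \<open>real^'k^'k\<close>, \<open>norm\<close> is the Frobenius norm.\<close>

definition empirical_loss ::
  "(real^'n \<Rightarrow> real \<Rightarrow> real^'n) \<Rightarrow> (real^'n \<Rightarrow> real \<Rightarrow> real^'m^'n)
    \<Rightarrow> (real^'n \<Rightarrow> real \<Rightarrow> real^'k^'n) \<Rightarrow> real
    \<Rightarrow> nat \<Rightarrow> (nat \<Rightarrow> (real^'n) \<times> (real^'n) \<times> (real^'m) \<times> real)
    \<Rightarrow> nat \<Rightarrow> (nat \<Rightarrow> real^'n) \<Rightarrow> (nat \<Rightarrow> real^'k)
    \<Rightarrow> (real^'n \<Rightarrow> real^'n \<Rightarrow> real^'m \<Rightarrow> real \<Rightarrow> real^'m)
    \<Rightarrow> (real^'n \<Rightarrow> real \<Rightarrow> real^'n^'n) \<Rightarrow> real \<Rightarrow> real" where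
  "empirical_loss f B Bp \<alpha> N \<xi> K p p' uL W mlow =
     (\<Sum>i<N. case \<xi> i of (x, xd, ud, t) \<Rightarrow>
        (L_PD K p (- contraction_mat (ctrl_affine f B) (\<lambda>y s. matrix_inv (W y s)) \<alpha>
                       (\<lambda>y. uL y xd ud t) x t)
         + L_PD K p (inverse mlow *\<^sub>R mat 1 - W x t))
        + (L_PD K p' (- C1_mat f Bp \<alpha> W x t) + (\<Sum>j\<in>UNIV. norm (C2_mat B Bp j W x t))))
     / real N"

end

theory Submission
  imports Defs
begin

text \<open>Let \<open>D t\<close> be the geodesic distance from \<open>xd t\<close> to \<open>x t\<close> in the metric at time \<open>t\<close>, that is,
  the infimum of the weighted lengths of all \<open>C\<^sup>1\<close> curves joining the two points. The bound is proved
  for \<open>D\<close>, which satisfies \<open>D 0 \<le> V_ell \<Theta> q 0\<close> and \<open>sqrt mlow * norm (x t - xd t) \<le> D t\<close>;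
  the virtual family enters only through \<open>t = 0\<close>. Differentiating \<open>V_ell\<close> itself is not possible:
  the contraction condition controls the derivative of the metric along the undisturbed field only,
  whereas the virtual trajectories also move along the disturbance, and nothing is assumed about
  their joint regularity.

  Near a time \<open>\<tau>\<close>, push a nearly shortest curve at time \<open>a\<close> by one Euler step of the undisturbed
  closed loop frozen at \<open>\<tau>\<close>. By contraction the length at time \<open>b\<close> is at most
  \<open>1 - \<alpha> (b - a) + o(b - a)\<close> times the old one, uniformly over curves in a compact set. The end
  points are then off by at most \<open>(b - a) norm v + o(b - a)\<close>, where \<open>v\<close> is the disturbance acting
  on \<open>x\<close>, and correcting them costs this much length times \<open>sqrt mup\<close>. As \<open>norm v\<close> is bounded by
  \<open>Lu * \<epsilon>0 + dbar + Lu * \<epsilon>1 * norm (x - xd)\<close>, a Gronwall argument for straddling intervals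
  \<open>a \<le> \<tau> \<le> b\<close> finishes the proof.\<close>

section \<open>Curves and the geodesic distance\<close>

lemma Ck_on_1E:
  assumes "Ck_on 1 U f"
  obtains f' where "\<And>z. z \<in> U \<Longrightarrow> (f has_derivative f' z) (at z within U)"
    and "\<And>v. continuous_on U (\<lambda>z. f' z v)"
  using assms unfolding One_nat_def Ck_on.simps by blast

text \<open>Length integrals use velocities, whereas \<open>Ck_on\<close> supplies Frechet
  derivatives, continuous in each fixed direction. On the real line a linear map is determined by
  its value at 1, which is the velocity.\<close>

lemma C1_pathE:
  fixes \<gamma> :: "real \<Rightarrow> real^'n"
  assumes "C1_path \<gamma> a b"
  obtains \<gamma>' where "\<And>s. s \<in> {0..1} \<Longrightarrow> (\<gamma> has_vector_derivative \<gamma>' s) (at s within {0..1})"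
    and "continuous_on {0..1} \<gamma>'" and "\<gamma> 0 = a" and "\<gamma> 1 = b"
proof -
  from assms have ck: "Ck_on 1 {0..1} \<gamma>" and e: "\<gamma> 0 = a" "\<gamma> 1 = b"
    by (auto simp: C1_path_def pathstart_def pathfinish_def)
  from ck obtain f' where f': "\<And>z. z \<in> {0..1} \<Longrightarrow> (\<gamma> has_derivative f' z) (at z within {0..1})"
    "\<And>v. continuous_on {0..1} (\<lambda>z. f' z v)" by (rule Ck_on_1E) blast
  have d: "(\<gamma> has_vector_derivative f' s 1) (at s within {0..1})" if "s \<in> {0..1}" for s
  proof -
    interpret bounded_linear "f' s" using f'(1)[OF that] by (rule has_derivative_bounded_linear)
    have "f' s r = r *\<^sub>R f' s 1" for r using scaleR[of r 1] by simp
    then have "f' s = (\<lambda>r. r *\<^sub>R f' s 1)" by blast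
    with f'(1)[OF that] show ?thesis by (simp add: has_vector_derivative_def)
  qed
  show ?thesis by (rule that[OF d f'(2)[of 1] e])
qed

lemma C1_pathI:
  fixes \<gamma> :: "real \<Rightarrow> real^'n"
  assumes "\<And>s. s \<in> {0..1} \<Longrightarrow> (\<gamma> has_vector_derivative \<gamma>' s) (at s within {0..1})"
    and "continuous_on {0..1} \<gamma>'" and "\<gamma> 0 = a" and "\<gamma> 1 = b"
  shows "C1_path \<gamma> a b"
proof -
  have "Ck_on 1 {0..1} \<gamma>"
    unfolding One_nat_def Ck_on.simps
    using assms(1,2) unfolding has_vector_derivative_def
    by (intro exI[of _ "\<lambda>s r. r *\<^sub>R \<gamma>' s"]) (auto intro!: continuous_intros)
  with assms(3,4) show ?thesis by (simp add: C1_path_def pathstart_def pathfinish_def)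
qed

lemma weighted_length_int_eq:
  fixes \<gamma> :: "real \<Rightarrow> real^'n"
  assumes "\<And>s. s \<in> {0..1} \<Longrightarrow> (\<gamma> has_vector_derivative \<gamma>' s) (at s within {0..1})"
  shows "weighted_length_int G \<gamma> = integral {0..1} (\<lambda>s. norm (G (\<gamma> s) *v \<gamma>' s))"
  unfolding weighted_length_int_def
  by (rule integral_cong) (use vector_derivative_within_closed_interval[OF _ _ assms] in auto)

lemma length_int_eq:
  fixes \<gamma> :: "real \<Rightarrow> real^'n"
  assumes "\<And>s. s \<in> {0..1} \<Longrightarrow> (\<gamma> has_vector_derivative \<gamma>' s) (at s within {0..1})"
  shows "length_int \<gamma> = integral {0..1} (\<lambda>s. norm (\<gamma>' s))"
  unfolding length_int_def
  by (rule integral_cong) (use vector_derivative_within_closed_interval[OF _ _ assms] in auto)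

text \<open>The displacement is the integral of the velocity over an initial piece of
  \<open>{0..1}\<close>. At \<open>s = 1\<close> this compares chord and length; for general
  \<open>s\<close> it confines nearly shortest curves to a ball.\<close>

lemma norm_path_diff_le_length_int:
  fixes \<gamma> :: "real \<Rightarrow> real^'n"
  assumes "C1_path \<gamma> a b" "s \<in> {0..1}"
  shows "norm (\<gamma> s - a) \<le> length_int \<gamma>"
proof -
  from assms(1) obtain \<gamma>' where d: "\<And>s. s \<in> {0..1} \<Longrightarrow> (\<gamma> has_vector_derivative \<gamma>' s) (at s within {0..1})"
    and c: "continuous_on {0..1} \<gamma>'" and e: "\<gamma> 0 = a" "\<gamma> 1 = b" by (rule C1_pathE) blast
  have sub: "{0..s} \<subseteq> {0..1}" using assms(2) by auto
  have "(\<gamma>' has_integral (\<gamma> s - \<gamma> 0)) {0..s}"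
    using assms(2) by (intro fundamental_theorem_of_calculus) (auto intro: has_vector_derivative_within_subset[OF d])
  then have "\<gamma> s - a = integral {0..s} \<gamma>'" by (simp add: e integral_unique)
  also have "norm \<dots> \<le> integral {0..s} (\<lambda>s. norm (\<gamma>' s))"
    by (rule integral_norm_bound_integral)
      (auto intro!: integrable_continuous_real continuous_intros continuous_on_subset[OF c sub])
  also have "\<dots> \<le> integral {0..1} (\<lambda>s. norm (\<gamma>' s))"
    by (rule integral_subset_le[OF sub])
      (auto intro!: integrable_continuous_real continuous_intros continuous_on_subset[OF c sub] c)
  finally show ?thesis by (subst length_int_eq[OF d]) auto
qed

lemma has_vector_derivative_affine:
  "((\<lambda>s. a + s *\<^sub>R v) has_vector_derivative v) (at s within S)"
  by (auto intro!: derivative_eq_intros)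

lemma C1_path_linepath: "C1_path (\<lambda>s. a + s *\<^sub>R (b - a)) a (b :: real^'n)"
  by (rule C1_pathI[of _ "\<lambda>_. b - a"]) (auto intro!: derivative_eq_intros)

lemma length_int_linepath: "length_int (\<lambda>s. a + s *\<^sub>R (b - a)) = norm (b - a :: real^'n)"
  by (subst length_int_eq[of _ "\<lambda>_. b - a"]) (auto intro!: derivative_eq_intros)

text \<open>Serves to derive \<open>0 \<le> \<epsilon>1\<close>, for which curves of arbitrary
  length between given points are wanted. A parabolic bump added to the segment vanishes at both
  ends and drives the midpoint far away.\<close>

lemma exists_long_C1_path:
  fixes a b :: "real^'n"
  obtains \<gamma> where "C1_path \<gamma> a b" "L \<le> length_int \<gamma>"
proof -
  define e :: "real^'n" where "e = axis undefined 1"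
  \<comment> \<open>At \<open>s = 1/2\<close> the bump has height
    \<open>r / 4 = \<bar>L\<bar> + norm (b - a)\<close>; even after subtracting the half chord, at
    least \<open>\<bar>L\<bar>\<close> remains.\<close>
  define r where "r = 4 * (\<bar>L\<bar> + norm (b - a))"
  define \<gamma> where "\<gamma> = (\<lambda>s::real. a + s *\<^sub>R (b - a) + (r * (s - s^2)) *\<^sub>R e)"
  have "C1_path \<gamma> a b" unfolding \<gamma>_def
    by (rule C1_pathI[of _ "\<lambda>s. (b - a) + (r * (1 - 2 * s)) *\<^sub>R e"])
      (auto intro!: derivative_eq_intros continuous_intros)
  moreover have "L \<le> length_int \<gamma>"
  proof -
    have n: "norm e = 1" by (simp add: e_def)
    have "r / 4 = norm ((r / 4) *\<^sub>R e)" by (simp add: n r_def)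
    also have "(r / 4) *\<^sub>R e = (\<gamma> (1/2) - a) - (1/2) *\<^sub>R (b - a)"
      by (simp add: \<gamma>_def power2_eq_square)
    also have "norm \<dots> \<le> norm (\<gamma> (1/2) - a) + norm ((1/2) *\<^sub>R (b - a))" by (rule norm_triangle_ineq4)
    also have "norm (\<gamma> (1/2) - a) \<le> length_int \<gamma>"
      using \<open>C1_path \<gamma> a b\<close> by (rule norm_path_diff_le_length_int) auto
    finally have "2 * norm (b - a) + 4 * \<bar>L\<bar> \<le> length_int \<gamma> * 4" by (simp add: r_def)
    with norm_ge_zero[of "b - a"] show ?thesis by linarith
  qed
  ultimately show ?thesis by (rule that)
qed

section \<open>Lengths and distances in the metric of one time slice\<close>

lemma continuous_on_matrix_vector_mult [continuous_intros]:
  fixes A :: "'a::topological_space \<Rightarrow> real^'n^'m"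
  assumes "continuous_on S A" "continuous_on S w"
  shows "continuous_on S (\<lambda>s. A s *v w s)"
  unfolding matrix_vector_mult_def
  by (intro continuous_intros assms)

lemma norm_mult_vec_sq: "(norm (A *v v))\<^sup>2 = v \<bullet> ((transpose A ** A) *v v)"
  for A :: "real^'n^'m"
  by (simp add: power2_norm_eq_inner dot_lmul_matrix[symmetric] flip: matrix_vector_mul_assoc)
    (rule inner_commute)

definition geodesic_dist :: "(real^'n \<Rightarrow> real^'n^'n) \<Rightarrow> real^'n \<Rightarrow> real^'n \<Rightarrow> real" where
  "geodesic_dist G a b = Inf {weighted_length_int G \<gamma> |\<gamma>. C1_path \<gamma> a b}"

text \<open>\<open>G\<close> stands for \<open>\<Theta>\<close> at a frozen time, with
  \<open>c\<close> and \<open>C\<close> the square roots of the metric bounds. Continuity is asked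
  of \<open>transpose (G y) ** G y\<close> because the contraction hypothesis gives regularity of
  the metric, not of its factor.\<close>

locale metric_factor =
  fixes G :: "real^'n \<Rightarrow> real^'n^'n" and c C :: real
  assumes continuous_metric: "continuous_on UNIV (\<lambda>y. transpose (G y) ** G y)"
    and c_pos: "0 < c"
    and lower: "c * norm v \<le> norm (G y *v v)"
    and upper: "norm (G y *v v) \<le> C * norm v"
begin

lemma C_nonneg: "0 \<le> C"
  using order_trans[OF norm_ge_zero upper[of undefined "axis undefined 1"]] by simp

text \<open>\<open>G\<close> itself may jump, but the square of the weighted norm is a quadratic
  form of the continuous metric.\<close>

lemma continuous_on_weighted_norm:
  assumes "continuous_on S \<gamma>" "continuous_on S w"
  shows "continuous_on S (\<lambda>s. norm (G (\<gamma> s) *v w s))"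
proof -
  have "continuous_on S (\<lambda>s. transpose (G (\<gamma> s)) ** G (\<gamma> s))"
    by (rule continuous_on_compose2[OF continuous_metric assms(1)]) simp
  then have "continuous_on S (\<lambda>s. sqrt (w s \<bullet> ((transpose (G (\<gamma> s)) ** G (\<gamma> s)) *v w s)))"
    by (intro continuous_on_real_sqrt continuous_on_inner continuous_on_matrix_vector_mult assms(2))
  then show ?thesis by (simp flip: norm_mult_vec_sq)
qed

lemma weighted_length_int_lower:
  assumes "C1_path \<gamma> a b"
  shows "c * length_int \<gamma> \<le> weighted_length_int G \<gamma>"
proof -
  from assms obtain \<gamma>' where d: "\<And>s. s \<in> {0..1} \<Longrightarrow> (\<gamma> has_vector_derivative \<gamma>' s) (at s within {0..1})"
    and cont: "continuous_on {0..1} \<gamma>'" by (rule C1_pathE) blast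
  have "c * length_int \<gamma> = integral {0..1} (\<lambda>s. c * norm (\<gamma>' s))"
    by (subst length_int_eq[OF d]) auto
  also have "\<dots> \<le> integral {0..1} (\<lambda>s. norm (G (\<gamma> s) *v \<gamma>' s))"
    by (intro integral_le integrable_continuous_real continuous_intros cont lower
        continuous_on_weighted_norm continuous_on_vector_derivative[OF d])
  finally show ?thesis by (subst weighted_length_int_eq[OF d]) auto
qed

lemma weighted_length_int_lower':
  assumes "C1_path \<gamma> a b"
  shows "c * norm (b - a) \<le> weighted_length_int G \<gamma>"
proof -
  have "\<gamma> 1 = b" using assms by (simp add: C1_path_def pathfinish_def)
  then have "norm (b - a) \<le> length_int \<gamma>"
    using norm_path_diff_le_length_int[OF assms, of 1] by simp
  then show ?thesis using weighted_length_int_lower[OF assms] c_pos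
    by (meson mult_left_mono less_imp_le order_trans)
qed

lemma geodesic_dist_le:
  assumes "C1_path \<gamma> a b"
  shows "geodesic_dist G a b \<le> weighted_length_int G \<gamma>"
  unfolding geodesic_dist_def
proof (rule cInf_lower)
  show "bdd_below {weighted_length_int G \<gamma> |\<gamma>. C1_path \<gamma> a b}"
    by (rule bdd_belowI[of _ "c * norm (b - a)"]) (clarify, rule weighted_length_int_lower')
qed (use assms in blast)

lemma near_geodesic:
  assumes "0 < e"
  obtains \<gamma> where "C1_path \<gamma> a b" "weighted_length_int G \<gamma> < geodesic_dist G a b + e"
proof -
  let ?S = "{weighted_length_int G \<gamma> |\<gamma>. C1_path \<gamma> a b}"
  have "?S \<noteq> {}" using C1_path_linepath[of a b] by blast
  moreover have "Inf ?S < geodesic_dist G a b + e" using assms by (simp add: geodesic_dist_def)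
  ultimately have "\<exists>l\<in>?S. l < geodesic_dist G a b + e" by (rule cInf_lessD)
  then show ?thesis using that by (elim bexE CollectE exE conjE) simp
qed

lemma geodesic_dist_lower: "c * norm (b - a) \<le> geodesic_dist G a b"
  unfolding geodesic_dist_def
proof (rule cInf_greatest)
  show "{weighted_length_int G \<gamma> |\<gamma>. C1_path \<gamma> a b} \<noteq> {}"
    using C1_path_linepath[of a b] by blast
qed (clarify, rule weighted_length_int_lower')

lemma geodesic_dist_upper: "geodesic_dist G a b \<le> C * norm (b - a)"
proof -
  have d: "((\<lambda>s. a + s *\<^sub>R (b - a)) has_vector_derivative b - a) (at s within {0..1})" for s
    by (rule has_vector_derivative_affine)
  have "geodesic_dist G a b \<le> weighted_length_int G (\<lambda>s. a + s *\<^sub>R (b - a))"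
    by (rule geodesic_dist_le[OF C1_path_linepath])
  also have "\<dots> = integral {0..1} (\<lambda>s. norm (G (a + s *\<^sub>R (b - a)) *v (b - a)))"
    by (rule weighted_length_int_eq) (rule d)
  also have "\<dots> \<le> integral {0..1} (\<lambda>s::real. C * norm (b - a))"
  proof (rule integral_le)
    show "(\<lambda>s. norm (G (a + s *\<^sub>R (b - a)) *v (b - a))) integrable_on {0..1}"
      by (intro integrable_continuous_real continuous_on_weighted_norm) (auto intro!: continuous_intros)
  qed (auto intro!: integrable_continuous_real upper)
  finally show ?thesis by simp
qed

text \<open>Instead of concatenating the curve with segments, add \<open>(1 - s)\<^sup>k (a' - a) + s\<^sup>k (b' - b)\<close>
  and let \<open>k\<close> tend to infinity.\<close>

lemma geodesic_dist_perturb: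
  assumes \<gamma>: "C1_path \<gamma> a b"
  shows "geodesic_dist G a' b' \<le> weighted_length_int G \<gamma> + C * (norm (a' - a) + norm (b' - b))"
proof -
  from \<gamma> obtain \<gamma>' where d: "\<And>s. s \<in> {0..1} \<Longrightarrow> (\<gamma> has_vector_derivative \<gamma>' s) (at s within {0..1})"
    and cont: "continuous_on {0..1} \<gamma>'" and e: "\<gamma> 0 = a" "\<gamma> 1 = b" by (rule C1_pathE) blast
  note cont\<gamma> = continuous_on_vector_derivative[OF d]
  define w0 w1 where "w0 = a' - a" and "w1 = b' - b"
  define \<beta> where "\<beta> = (\<lambda>k s. \<gamma> s + ((1 - s) ^ Suc k) *\<^sub>R w0 + (s ^ Suc k) *\<^sub>R w1)"
  define \<beta>' where "\<beta>' = (\<lambda>k s. \<gamma>' s - (real (Suc k) * (1 - s) ^ k) *\<^sub>R w0 + (real (Suc k) * s ^ k) *\<^sub>R w1)"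
  \<comment> \<open>\<open>p k s\<close> bounds the norm of the added velocity. Its integral is
    \<open>norm w0 + norm w1\<close> for every \<open>k\<close>, so the cost of moving the end
    points stays fixed while the correction concentrates at the ends of
    \<open>{0..1}\<close>.\<close>
  define p where "p = (\<lambda>k s. real (Suc k) * (1 - s) ^ k * norm w0 + real (Suc k) * s ^ k * norm w1)"
  have p0: "((\<lambda>s. (1 - s) ^ Suc k) has_real_derivative - (real (Suc k) * (1 - s) ^ k)) (at s within {0..1})"
    and p1: "((\<lambda>s. s ^ Suc k) has_real_derivative real (Suc k) * s ^ k) (at s within {0..1})" for s :: real and k
    by (auto intro!: DERIV_cong[OF DERIV_power_Suc] derivative_eq_intros simp del: power_Suc)
  have d\<beta>: "(\<beta> k has_vector_derivative \<beta>' k s) (at s within {0..1})" if "s \<in> {0..1}" for k s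
  proof -
    have "((\<lambda>s. ((1 - s) ^ Suc k) *\<^sub>R w0) has_vector_derivative - ((real (Suc k) * (1 - s) ^ k) *\<^sub>R w0)) (at s within {0..1})"
      using has_vector_derivative_scaleR[OF p0 has_vector_derivative_const[of w0]] by simp
    moreover have "((\<lambda>s. (s ^ Suc k) *\<^sub>R w1) has_vector_derivative (real (Suc k) * s ^ k) *\<^sub>R w1) (at s within {0..1})"
      using has_vector_derivative_scaleR[OF p1 has_vector_derivative_const[of w1]] by simp
    ultimately have "(\<beta> k has_vector_derivative \<gamma>' s + - ((real (Suc k) * (1 - s) ^ k) *\<^sub>R w0) +
        (real (Suc k) * s ^ k) *\<^sub>R w1) (at s within {0..1})"
      unfolding \<beta>_def by (intro has_vector_derivative_add d that)
    then show ?thesis by (simp add: \<beta>'_def)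
  qed
  have c\<beta>: "continuous_on {0..1} (\<beta> k)" and c\<beta>': "continuous_on {0..1} (\<beta>' k)" for k
    unfolding \<beta>_def \<beta>'_def by (intro continuous_on_add continuous_on_diff continuous_on_scaleR continuous_on_power continuous_on_mult continuous_on_const continuous_on_id cont cont\<gamma>; simp)+
  have path: "C1_path (\<beta> k) a' b'" for k
    by (rule C1_pathI[OF d\<beta> c\<beta>']) (auto simp: \<beta>_def e w0_def w1_def)
  have pint: "(p k has_integral (norm w0 + norm w1)) {0..1}" for k
  proof -
    have "((\<lambda>s. s ^ Suc k * norm w1 - (1 - s) ^ Suc k * norm w0) has_vector_derivative p k s)
        (at s within {0..1})" for s
    proof -
      have "((\<lambda>s. s ^ Suc k * norm w1 - (1 - s) ^ Suc k * norm w0) has_real_derivative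
          real (Suc k) * s ^ k * norm w1 - - (real (Suc k) * (1 - s) ^ k) * norm w0) (at s within {0..1})"
        by (intro DERIV_diff DERIV_cmult_right p0 p1)
      then show ?thesis
        by (simp add: p_def add.commute flip: has_real_derivative_iff_has_vector_derivative)
    qed
    then have "(p k has_integral ((1 ^ Suc k * norm w1 - (1 - 1) ^ Suc k * norm w0) -
        (0 ^ Suc k * norm w1 - (1 - 0) ^ Suc k * norm w0))) {0..1}"
      by (intro fundamental_theorem_of_calculus) auto
    then show ?thesis by (simp add: add.commute)
  qed
  let ?N = "\<lambda>k s. norm (G (\<beta> k s) *v \<gamma>' s)"
  have Nint: "?N k integrable_on {0..1}" for k
    by (intro integrable_continuous_real continuous_on_weighted_norm c\<beta> cont)
  have le: "geodesic_dist G a' b' \<le> integral {0..1} (?N k) + C * (norm w0 + norm w1)" for k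
  proof -
    have "geodesic_dist G a' b' \<le> weighted_length_int G (\<beta> k)" by (rule geodesic_dist_le[OF path])
    also have "\<dots> = integral {0..1} (\<lambda>s. norm (G (\<beta> k s) *v \<beta>' k s))"
      by (rule weighted_length_int_eq[OF d\<beta>])
    also have "\<dots> \<le> integral {0..1} (\<lambda>s. ?N k s + C * p k s)"
    proof (rule integral_le)
      show "(\<lambda>s. norm (G (\<beta> k s) *v \<beta>' k s)) integrable_on {0..1}"
        by (intro integrable_continuous_real continuous_on_weighted_norm c\<beta> c\<beta>')
      show "(\<lambda>s. ?N k s + C * p k s) integrable_on {0..1}"
        using pint by (intro integrable_add Nint integrable_on_mult_right) (auto intro: has_integral_integrable)
      fix s :: real assume s: "s \<in> {0..1}"
      let ?r = "(real (Suc k) * s ^ k) *\<^sub>R w1 - (real (Suc k) * (1 - s) ^ k) *\<^sub>R w0"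
      have "\<beta>' k s = \<gamma>' s + ?r" by (simp add: \<beta>'_def)
      then have "norm (G (\<beta> k s) *v \<beta>' k s) \<le> ?N k s + norm (G (\<beta> k s) *v ?r)"
        by (simp only: matrix_vector_right_distrib norm_triangle_ineq)
      moreover have "norm (G (\<beta> k s) *v ?r) \<le> C * norm ?r" by (rule upper)
      moreover have "norm ?r \<le> p k s" unfolding p_def
        using s by (intro order_trans[OF norm_triangle_ineq4]) auto
      ultimately show "norm (G (\<beta> k s) *v \<beta>' k s) \<le> ?N k s + C * p k s"
        using C_nonneg by (meson add_left_mono mult_left_mono order_trans)
    qed
    also have "\<dots> = integral {0..1} (?N k) + C * (norm w0 + norm w1)"
      using pint[of k]
      by (subst integral_add) (auto intro!: Nint integrable_on_mult_right intro: has_integral_integrable simp: integral_unique)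
    finally show ?thesis .
  qed
  \<comment> \<open>The pointwise limit of the integrands. At \<open>s = 0\<close> and
    \<open>s = 1\<close> one of the two powers is always 1, so the base point stays shifted there;
    these two points do not affect the integral.\<close>
  define g where "g = (\<lambda>s. if s = 0 then norm (G (\<gamma> s + w0) *v \<gamma>' s) else
     if s = 1 then norm (G (\<gamma> s + w1) *v \<gamma>' s) else norm (G (\<gamma> s) *v \<gamma>' s))"
  have lim: "(\<lambda>k. ?N k s) \<longlonglongrightarrow> g s" if s: "s \<in> {0..1}" for s
  proof -
    consider "s = 0" | "s = 1" | "0 < s" "s < 1" using s by force
    then show ?thesis
    proof cases
      case 3
      have "(\<lambda>k. \<gamma> s + ((1 - s) ^ Suc k) *\<^sub>R w0 + (s ^ Suc k) *\<^sub>R w1) \<longlonglongrightarrow> \<gamma> s + 0 *\<^sub>R w0 + 0 *\<^sub>R w1"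
        using 3 by (intro tendsto_intros LIMSEQ_Suc LIMSEQ_power_zero) auto
      then have b: "(\<lambda>k. \<beta> k s) \<longlonglongrightarrow> \<gamma> s" by (simp add: \<beta>_def)
      have "continuous_on UNIV (\<lambda>y. norm (G y *v \<gamma>' s))"
        by (rule continuous_on_weighted_norm) auto
      then have "isCont (\<lambda>y. norm (G y *v \<gamma>' s)) (\<gamma> s)"
        by (simp add: continuous_on_eq_continuous_at)
      from isCont_tendsto_compose[OF this b] 3 show ?thesis by (simp add: g_def)
    qed (simp_all add: g_def \<beta>_def)
  qed
  \<comment> \<open>The integrands \<open>?N k\<close> carry the original velocity
    \<open>\<gamma>'\<close>, hence \<open>C * norm (\<gamma>' s)\<close> dominates all of
    them.\<close>
  have "(\<lambda>k. integral {0..1} (?N k)) \<longlonglongrightarrow> integral {0..1} g"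
  proof (rule dominated_convergence(2)[OF Nint _ _ lim])
    show "(\<lambda>s. C * norm (\<gamma>' s)) integrable_on {0..1}"
      by (intro integrable_continuous_real continuous_intros cont)
  qed (use upper in auto)
  moreover have "integral {0..1} (\<lambda>s. norm (G (\<gamma> s) *v \<gamma>' s)) = integral {0..1} g"
    by (rule integral_spike[of "{0, 1}"]) (auto simp: g_def)
  then have "integral {0..1} g = weighted_length_int G \<gamma>"
    using weighted_length_int_eq[of \<gamma> \<gamma>' G] d by simp
  ultimately have "(\<lambda>k. integral {0..1} (?N k) + C * (norm w0 + norm w1)) \<longlonglongrightarrow>
      weighted_length_int G \<gamma> + C * (norm w0 + norm w1)"
    by (intro tendsto_intros) simp
  then show ?thesis using le unfolding w0_def w1_def by (intro LIMSEQ_le_const) auto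
qed

end

section \<open>Derivatives of the metric and of the closed loop\<close>

text \<open>Expanding the direction in the finite basis and using linearity upgrades continuity for
  each fixed direction, which is all that \<open>Ck_on\<close> gives, to joint continuity in base
  point and direction.\<close>

lemma continuous_on_apply_derivative:
  fixes f' :: "'a::topological_space \<Rightarrow> 'b::euclidean_space \<Rightarrow> 'c::real_normed_vector"
  assumes lin: "\<And>z. z \<in> U \<Longrightarrow> linear (f' z)" and cont: "\<And>v. continuous_on U (\<lambda>z. f' z v)"
    and h: "continuous_on X h" "\<And>x. x \<in> X \<Longrightarrow> h x \<in> U" and k: "continuous_on X k"
  shows "continuous_on X (\<lambda>x. f' (h x) (k x))"
proof -
  have "f' (h x) (k x) = (\<Sum>b\<in>Basis. (k x \<bullet> b) *\<^sub>R f' (h x) b)" if "x \<in> X" for x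
  proof -
    have "f' (h x) (k x) = f' (h x) (\<Sum>b\<in>Basis. (k x \<bullet> b) *\<^sub>R b)"
      by (simp add: euclidean_representation)
    also have "\<dots> = (\<Sum>b\<in>Basis. (k x \<bullet> b) *\<^sub>R f' (h x) b)"
      using lin[OF h(2)[OF that]] by (simp add: linear_sum linear_scale)
    finally show ?thesis .
  qed
  moreover have "continuous_on X (\<lambda>x. \<Sum>b\<in>Basis. (k x \<bullet> b) *\<^sub>R f' (h x) b)"
    by (intro continuous_on_sum continuous_on_scaleR continuous_on_inner k continuous_on_const
        continuous_on_compose2[OF cont h(1)]) (use h(2) in auto)
  ultimately show ?thesis by (simp cong: continuous_on_cong)
qed

lemma Ck_on_1_slice:
  fixes f :: "'a::real_normed_vector \<Rightarrow> real \<Rightarrow> 'b::real_normed_vector"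
  assumes "Ck_on 1 (UNIV \<times> {0..}) (\<lambda>(y, t). f y t)" "0 \<le> t"
  shows "Ck_on 1 UNIV (\<lambda>y. f y t)"
proof -
  from assms(1) obtain f' where
    d: "\<And>z. z \<in> UNIV \<times> {0..} \<Longrightarrow> ((\<lambda>(y, t). f y t) has_derivative f' z) (at z within UNIV \<times> {0..})"
    and c: "\<And>v. continuous_on (UNIV \<times> {0..}) (\<lambda>z. f' z v)" by (rule Ck_on_1E) blast
  have "((\<lambda>y. f y t) has_derivative (\<lambda>v. f' (y, t) (v, 0))) (at y)" for y
  proof -
    have "((\<lambda>y. case (y, t) of (y, t) \<Rightarrow> f y t) has_derivative (\<lambda>v. f' (y, t) (v, 0))) (at y within UNIV)"
      by (rule has_derivative_in_compose2[of "UNIV \<times> {0..}" _ f' "\<lambda>y. (y, t)"])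
        (use assms(2) d in \<open>auto intro!: derivative_eq_intros\<close>)
    then show ?thesis by simp
  qed
  moreover have "continuous_on UNIV (\<lambda>y. f' (y, t) (v, 0))" for v
    by (rule continuous_on_compose2[OF c]) (use assms(2) in \<open>auto intro!: continuous_intros\<close>)
  ultimately show ?thesis
    unfolding One_nat_def Ck_on.simps by (intro exI[of _ "\<lambda>y v. f' (y, t) (v, 0)"]) simp
qed

lemma Ck_on_1_has_derivative_jacobian:
  fixes g :: "real^'n \<Rightarrow> real^'m"
  assumes "Ck_on 1 UNIV g"
  shows "(g has_derivative (*v) (jacobian g (at y))) (at y)"
    and "continuous_on UNIV (\<lambda>y. jacobian g (at y))"
proof -
  from assms obtain g' where d': "\<And>y. y \<in> UNIV \<Longrightarrow> (g has_derivative g' y) (at y)"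
    and c: "\<And>v. continuous_on UNIV (\<lambda>y. g' y v)" by (rule Ck_on_1E) blast
  note d = d'[OF UNIV_I]
  show "(g has_derivative (*v) (jacobian g (at y))) (at y)"
    using d[of y] by (simp add: differentiableI flip: jacobian_works)
  have "jacobian g (at y) = (\<chi> i j. g' y (axis j 1) $ i)" for y
    using frechet_derivative_at[OF d[of y]] by (simp add: jacobian_def matrix_def)
  then show "continuous_on UNIV (\<lambda>y. jacobian g (at y))"
    by (simp, intro continuous_on_vec_lambda continuous_on_component c)
qed

lemma bounded_bilinear_matrix_vector_mult:
  "bounded_bilinear ((*v) :: real^'m^'n \<Rightarrow> real^'m \<Rightarrow> real^'n)"
  unfolding bilinear_conv_bounded_bilinear[symmetric] bilinear_def
  by (auto intro!: linearI simp: matrix_vector_right_distrib matrix_vector_mult_add_rdistrib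
      matrix_vector_mult_scaleR scaleR_matrix_vector_assoc)

lemma Ck_on_1_matrix_vector_mult:
  fixes B :: "'a::real_normed_vector \<Rightarrow> real^'m^'n" and k :: "'a \<Rightarrow> real^'m"
  assumes "Ck_on 1 U f" "Ck_on 1 U B" "Ck_on 1 U k"
  shows "Ck_on 1 U (\<lambda>y. f y + B y *v k y)"
proof -
  from assms(1) obtain f' where df: "\<And>y. y \<in> U \<Longrightarrow> (f has_derivative f' y) (at y within U)"
    and cf: "\<And>v. continuous_on U (\<lambda>y. f' y v)" by (rule Ck_on_1E) blast
  from assms(2) obtain B' where dB: "\<And>y. y \<in> U \<Longrightarrow> (B has_derivative B' y) (at y within U)"
    and cB: "\<And>v. continuous_on U (\<lambda>y. B' y v)" by (rule Ck_on_1E) blast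
  from assms(3) obtain k' where dk: "\<And>y. y \<in> U \<Longrightarrow> (k has_derivative k' y) (at y within U)"
    and ck: "\<And>v. continuous_on U (\<lambda>y. k' y v)" by (rule Ck_on_1E) blast
  note D = has_derivative_add[OF df bounded_bilinear.FDERIV[OF bounded_bilinear_matrix_vector_mult dB dk]]
  have cont: "continuous_on U B" "continuous_on U k"
    using has_derivative_continuous_on[OF dB] has_derivative_continuous_on[OF dk] by simp_all
  show ?thesis
    unfolding One_nat_def Ck_on.simps
    by (intro exI[of _ "\<lambda>y v. f' y v + (B y *v k' y v + B' y v *v k y)"] conjI ballI allI D
        continuous_on_add continuous_on_matrix_vector_mult cf cB ck cont)
qed

lemma quadratic_msym: "v \<bullet> (msym A *v v) = v \<bullet> (A *v v)"
proof -
  have "v \<bullet> (transpose A *v v) = v \<bullet> (A *v v)"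
    by (simp add: inner_commute[of v] dot_lmul_matrix)
  then show ?thesis
    by (simp add: msym_def matrix_vector_mult_add_rdistrib inner_add_right flip: scaleR_matrix_vector_assoc)
qed

lemma transpose_metric: "transpose (metric \<Theta> x t) = metric \<Theta> x t"
  by (simp add: metric_def matrix_transpose_mul)

lemma metric_self_adjoint: "v \<bullet> (metric \<Theta> x t *v w) = w \<bullet> (metric \<Theta> x t *v v)"
proof -
  have "v \<bullet> (metric \<Theta> x t *v w) = (transpose (metric \<Theta> x t) *v v) \<bullet> w"
    by (simp add: dot_lmul_matrix)
  then show ?thesis by (simp only: transpose_metric inner_commute)
qed

text \<open>By the chain rule along coordinate lines, the partial derivatives are the values of
  \<open>M'\<close> at \<open>(0, 1)\<close> and at \<open>(axis k 1, 0)\<close>; linearity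
  assembles them.\<close>

lemma total_derivative_eq:
  fixes M :: "real^'n \<Rightarrow> real \<Rightarrow> real^'n^'n"
  assumes D: "((\<lambda>(y, t). M y t) has_derivative M') (at (x, t) within UNIV \<times> {0..})" and t: "0 \<le> t"
  shows "dt_mat M x t + dir_mat p M x t = M' (p, 1)"
proof -
  interpret bounded_linear M' using D by (rule has_derivative_bounded_linear)
  have "((\<lambda>s. M x s) has_vector_derivative M' (0, 1)) (at t within {0..})"
  proof -
    have "((\<lambda>s. (x, s)) has_derivative (\<lambda>r. (0, r))) (at t within {0..})"
      by (auto intro!: derivative_eq_intros)
    moreover have "((\<lambda>(y, t). M y t) has_derivative M') (at (x, t) within (\<lambda>s. (x, s)) ` {0..})"
      by (rule has_derivative_subset[OF D]) auto
    ultimately have "((\<lambda>s. case (x, s) of (y, t) \<Rightarrow> M y t) has_derivative (\<lambda>r. M' (0, r))) (at t within {0..})"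
      by (rule has_derivative_in_compose)
    then have "((\<lambda>s. M x s) has_derivative (\<lambda>r. M' (0, r))) (at t within {0..})" by simp
    moreover have "(\<lambda>r. M' (0, r)) = (\<lambda>r. r *\<^sub>R M' (0, 1))"
    proof
      show "M' (0, r) = r *\<^sub>R M' (0, 1)" for r using scaleR[of r "(0, 1)"] by simp
    qed
    ultimately show ?thesis by (simp only: has_vector_derivative_def)
  qed
  \<comment> \<open>The derivative within \<open>{0..}\<close> is unique because \<open>t\<close> is
    a limit point of that set, even for \<open>t = 0\<close>: the interval \<open>{t..t+1}\<close>
    to the right suffices.\<close>
  then have 1: "dt_mat M x t = M' (0, 1)"
    unfolding dt_mat_def
    by (rule vector_derivative_within[rotated])
      (use t islimpt_subset[of t "{t..t+1}" "{0..}"] in \<open>simp add: trivial_limit_within\<close>)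
  have "vector_derivative (\<lambda>s. M (x + s *\<^sub>R axis k 1) t) (at 0) = M' (axis k 1, 0)" for k
  proof (rule vector_derivative_at)
    let ?h = "\<lambda>s::real. (x + s *\<^sub>R axis k (1::real), t)"
    have "((\<lambda>s::real. (x + s *\<^sub>R axis k (1::real), t)) has_derivative (\<lambda>r. (r *\<^sub>R axis k 1, 0))) (at 0)"
      by (auto intro!: derivative_eq_intros)
    moreover have "((\<lambda>(y, t). M y t) has_derivative M') (at (?h 0) within range ?h)"
      using has_derivative_subset[OF D, of "range ?h"] t by auto
    ultimately have "((\<lambda>s. case ?h s of (y, t) \<Rightarrow> M y t) has_derivative (\<lambda>r. M' (r *\<^sub>R axis k 1, 0))) (at 0)"
      by (rule has_derivative_in_compose)
    then have "((\<lambda>s. M (x + s *\<^sub>R axis k 1) t) has_derivative (\<lambda>r. M' (r *\<^sub>R axis k 1, 0))) (at 0)" by simp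
    moreover have "(\<lambda>r. M' (r *\<^sub>R axis k 1, 0)) = (\<lambda>r. r *\<^sub>R M' (axis k 1, 0))"
    proof
      show "M' (r *\<^sub>R axis k 1, 0) = r *\<^sub>R M' (axis k 1, 0)" for r
        using scaleR[of r "(axis k 1, 0)"] by simp
    qed
    ultimately show "((\<lambda>s. M (x + s *\<^sub>R axis k 1) t) has_vector_derivative M' (axis k 1, 0)) (at 0)"
      by (simp only: has_vector_derivative_def)
  qed
  then have "dir_mat p M x t = (\<Sum>k\<in>UNIV. M' (p $ k *\<^sub>R (axis k 1, 0)))"
    by (simp add: dir_mat_def scaleR del: scaleR_Pair)
  also have "\<dots> = M' (\<Sum>k\<in>UNIV. p $ k *\<^sub>R (axis k 1, 0))" by (rule sum[symmetric])
  also have "(\<Sum>k\<in>UNIV. p $ k *\<^sub>R (axis k 1, 0)) = ((\<Sum>k\<in>UNIV. p $ k *\<^sub>R axis k 1), 0 :: real)"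
    by (simp add: prod_eq_iff fst_sum snd_sum)
  also have "(\<Sum>k\<in>UNIV. p $ k *\<^sub>R axis k 1) = p"
    using basis_expansion[of p] by (simp add: scalar_mult_eq_scaleR)
  finally show ?thesis using 1 add[of "(0, 1)" "(p, 0)"] by simp
qed

text \<open>A quadratic form does not see \<open>msym\<close>, and self-adjointness of the metric
  splits the Jacobian term in two. The result has the shape of a derivative at \<open>r = 0\<close>
  of the metric's quadratic form along the Euler step \<open>v + r (A v)\<close>, plus the decay
  term.\<close>

lemma contraction_quadratic_le:
  fixes \<kappa> :: "real^'n \<Rightarrow> real^'m"
  assumes contr: "contraction_mat h (metric \<Theta>) \<alpha> \<kappa> x t \<preceq> 0" and t: "0 \<le> t"
    and D: "((\<lambda>(y, t). metric \<Theta> y t) has_derivative M') (at (x, t) within UNIV \<times> {0..})"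
  defines "A \<equiv> jacobian (\<lambda>y. h y (\<kappa> y) t) (at x)"
  shows "(A *v v) \<bullet> (metric \<Theta> x t *v v) + v \<bullet> (M' (h x (\<kappa> x) t, 1) *v v)
    + v \<bullet> (metric \<Theta> x t *v (A *v v)) + 2 * \<alpha> * (v \<bullet> (metric \<Theta> x t *v v)) \<le> 0"
proof -
  have "0 \<le> v \<bullet> ((0 - contraction_mat h (metric \<Theta>) \<alpha> \<kappa> x t) *v v)"
    using contr unfolding loewner_le_def psd_def by blast
  then have "v \<bullet> (contraction_mat h (metric \<Theta>) \<alpha> \<kappa> x t *v v) \<le> 0"
    by (simp only: matrix_vector_mult_diff_rdistrib inner_diff_right) simp
  moreover have "(A *v v) \<bullet> (metric \<Theta> x t *v v) = v \<bullet> (metric \<Theta> x t *v (A *v v))"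
    by (rule metric_self_adjoint)
  ultimately show ?thesis
    unfolding contraction_mat_def total_derivative_eq[OF D t]
    by (simp add: matrix_vector_mult_add_rdistrib inner_add_right quadratic_msym A_def
        matrix_vector_mul_assoc flip: scaleR_matrix_vector_assoc)
qed

section \<open>Contraction of curve lengths\<close>

text \<open>The field is frozen at \<open>\<tau>\<close> because no regularity of the feedback in
  time is assumed. By the mean value theorem the form changes by \<open>s\<close> times its
  derivative at an intermediate \<open>r\<close>. With the decay term added, that derivative is
  nonpositive for \<open>a = \<tau>\<close>, \<open>r = 0\<close> by contraction; uniform continuity
  over a compact set of points, times and unit vectors extends this to nearby \<open>a\<close> and
  \<open>r\<close> up to \<open>\<eta>\<close>.\<close>

lemma contraction_push_quadratic:
  fixes \<Theta> :: "real^'n \<Rightarrow> real \<Rightarrow> real^'n^'n" and \<kappa> :: "real^'n \<Rightarrow> real^'m"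
    and h :: "real^'n \<Rightarrow> real^'m \<Rightarrow> real \<Rightarrow> real^'n" and \<tau> \<alpha> \<eta> :: real and K :: "(real^'n) set"
  defines "g \<equiv> \<lambda>y. h y (\<kappa> y) \<tau>"
  defines "A \<equiv> \<lambda>y. jacobian g (at y)"
  defines "M \<equiv> metric \<Theta>"
  assumes M: "Ck_on 1 (UNIV \<times> {0..}) (\<lambda>(y, t). M y t)"
    and g: "Ck_on 1 UNIV g"
    and contr: "\<And>y. contraction_mat h M \<alpha> \<kappa> y \<tau> \<preceq> 0"
    and \<tau>: "0 \<le> \<tau>" and K: "compact K" and \<eta>: "0 < \<eta>"
  shows "\<exists>\<delta>>0. \<forall>a s y v. 0 \<le> a \<longrightarrow> a \<le> \<tau> \<longrightarrow> \<tau> \<le> a + s \<longrightarrow> s < \<delta> \<longrightarrow> y \<in> K \<longrightarrow>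
    (v + s *\<^sub>R (A y *v v)) \<bullet> (M (y + s *\<^sub>R g y) (a + s) *v (v + s *\<^sub>R (A y *v v)))
      \<le> (1 - 2 * \<alpha> * s) * (v \<bullet> (M y a *v v)) + \<eta> * s * (norm v)\<^sup>2"
proof -
  from M obtain M' where
    D: "\<And>z. z \<in> UNIV \<times> {0..} \<Longrightarrow> ((\<lambda>(y, t). M y t) has_derivative M' z) (at z within UNIV \<times> {0..})"
    and cM': "\<And>v. continuous_on (UNIV \<times> {0..}) (\<lambda>z. M' z v)" by (rule Ck_on_1E) blast
  have linM': "linear (M' z)" if "z \<in> UNIV \<times> {0..}" for z
    using has_derivative_linear[OF D[OF that]] .
  have cM: "continuous_on (UNIV \<times> {0..}) (\<lambda>(y, t). M y t)"
    by (rule has_derivative_continuous_on[OF D])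
  have cA: "continuous_on UNIV A" unfolding A_def by (rule Ck_on_1_has_derivative_jacobian(2)[OF g])
  have cg: "continuous_on UNIV g"
    by (rule has_derivative_continuous_on[OF Ck_on_1_has_derivative_jacobian(1)[OF g]])
  define Z where "Z = (\<lambda>(y, a, r, v :: real^'n). (y + r *\<^sub>R g y, a + r))"
  define W where "W = (\<lambda>(y, a :: real, r, v). v + r *\<^sub>R (A y *v v))"
  \<comment> \<open>The derivative is taken at the moved point \<open>Z p\<close>, but the decay
    term stays at \<open>(y, a)\<close>, since the pushed form is to be compared with the form
    before the push.\<close>
  define \<Psi> where "\<Psi> = (\<lambda>p. case p of (y, a, r, v) \<Rightarrow>
      (A y *v v) \<bullet> ((\<lambda>(y, t). M y t) (Z p) *v W p) + W p \<bullet> (M' (Z p) (g y, 1) *v W p)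
      + W p \<bullet> ((\<lambda>(y, t). M y t) (Z p) *v (A y *v v)) + 2 * \<alpha> * (v \<bullet> ((\<lambda>(y, t). M y t) (y, a) *v v)))"
  define X where "X = K \<times> {0..\<tau>} \<times> {0..1 :: real} \<times> sphere (0 :: real^'n) 1"
  have contX: "continuous_on X (\<lambda>p. g (fst p))" "continuous_on X (\<lambda>p. A (fst p))"
    by (rule continuous_on_compose2[OF cg] continuous_on_compose2[OF cA]; auto intro!: continuous_intros)+
  have cZ: "continuous_on X Z" and ZU: "\<And>p. p \<in> X \<Longrightarrow> Z p \<in> UNIV \<times> {0..}"
    unfolding Z_def case_prod_beta by (intro continuous_intros contX) (auto simp: X_def)
  have cW: "continuous_on X W"
    unfolding W_def case_prod_beta by (intro continuous_intros contX)
  have cMZ: "continuous_on X (\<lambda>p. (\<lambda>(y, t). M y t) (Z p))"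
    by (rule continuous_on_compose2[OF cM cZ]) (use ZU in blast)
  have cM0: "continuous_on X (\<lambda>p. (\<lambda>(y, t). M y t) (fst p, fst (snd p)))"
    by (rule continuous_on_compose2[OF cM]) (auto intro!: continuous_intros simp: X_def)
  have cM'Z: "continuous_on X (\<lambda>p. M' (Z p) (g (fst p), 1))"
    by (rule continuous_on_apply_derivative[OF linM' cM' cZ ZU]) (auto intro!: continuous_intros contX)
  have "continuous_on X \<Psi>"
    unfolding \<Psi>_def case_prod_beta[of "\<lambda>y x. case x of (a, r, v) \<Rightarrow> P y a r v" for P]
      case_prod_beta[of "\<lambda>a x. case x of (r, v) \<Rightarrow> P a r v" for P]
      case_prod_beta[of "\<lambda>r v. P r v :: real" for P]
    by (intro continuous_on_add continuous_on_inner continuous_on_matrix_vector_mult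
        continuous_on_mult continuous_on_const continuous_on_fst continuous_on_snd continuous_on_id
        contX cZ cW cMZ cM0 cM'Z)
  moreover have "compact X" unfolding X_def by (intro compact_Times K compact_Icc compact_sphere)
  ultimately have "uniformly_continuous_on X \<Psi>" by (rule compact_uniformly_continuous)
  then obtain \<delta> where \<delta>: "0 < \<delta>" "\<And>p p'. p \<in> X \<Longrightarrow> p' \<in> X \<Longrightarrow> dist p' p < \<delta> \<Longrightarrow> dist (\<Psi> p') (\<Psi> p) < \<eta>"
    using \<eta> unfolding uniformly_continuous_on_def by metis
  \<comment> \<open>The bound 1 on \<open>s\<close> keeps \<open>r\<close> in the range of
    \<open>X\<close>. The bound \<open>\<delta> / 2\<close> serves because \<open>(a, r)\<close> is
    within \<open>(\<tau> - a) + r < 2 * s\<close> of \<open>(\<tau>, 0)\<close>.\<close>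
  have unit: "(v + s *\<^sub>R (A y *v v)) \<bullet> (M (y + s *\<^sub>R g y) (a + s) *v (v + s *\<^sub>R (A y *v v)))
      \<le> (1 - 2 * \<alpha> * s) * (v \<bullet> (M y a *v v)) + \<eta> * s"
    if a: "0 \<le> a" "a \<le> \<tau>" "\<tau> \<le> a + s" and s: "s < min 1 (\<delta> / 2)" and y: "y \<in> K" and v: "norm v = 1"
    for a s y v
  proof (cases "s = 0")
    case True
    then show ?thesis by simp
  next
    case False
    with a have s0: "0 < s" by linarith
    define \<phi> where "\<phi> = (\<lambda>r. (v + r *\<^sub>R (A y *v v)) \<bullet> (M (y + r *\<^sub>R g y) (a + r) *v (v + r *\<^sub>R (A y *v v))))"
    define \<phi>' where "\<phi>' = (\<lambda>r t. (v + r *\<^sub>R (A y *v v)) \<bullet>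
        (M (y + r *\<^sub>R g y) (a + r) *v (t *\<^sub>R (A y *v v)) + M' (y + r *\<^sub>R g y, a + r) (t *\<^sub>R g y, t) *v (v + r *\<^sub>R (A y *v v)))
        + (t *\<^sub>R (A y *v v)) \<bullet> (M (y + r *\<^sub>R g y) (a + r) *v (v + r *\<^sub>R (A y *v v))))"
    have "(\<phi> has_derivative \<phi>' r) (at r within {0..s})" if r: "0 \<le> r" "r \<le> s" for r
    proof -
      let ?z = "\<lambda>r. (y + r *\<^sub>R g y, a + r)"
      have "(?z has_derivative (\<lambda>t. (t *\<^sub>R g y, t))) (at r within {0..s})"
        by (auto intro!: derivative_eq_intros)
      moreover have "((\<lambda>(y, t). M y t) has_derivative M' (?z r)) (at (?z r) within ?z ` {0..s})"
        by (rule has_derivative_subset[OF D]) (use r a in auto)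
      ultimately have "((\<lambda>r. case ?z r of (y, t) \<Rightarrow> M y t) has_derivative (\<lambda>t. M' (?z r) (t *\<^sub>R g y, t))) (at r within {0..s})"
        by (rule has_derivative_in_compose)
      then have DM: "((\<lambda>r. M (y + r *\<^sub>R g y) (a + r)) has_derivative (\<lambda>t. M' (?z r) (t *\<^sub>R g y, t))) (at r within {0..s})"
        by simp
      have Dw: "((\<lambda>r. v + r *\<^sub>R (A y *v v)) has_derivative (\<lambda>t. t *\<^sub>R (A y *v v))) (at r within {0..s})"
        by (auto intro!: derivative_eq_intros)
      show ?thesis unfolding \<phi>_def \<phi>'_def
        by (rule has_derivative_inner[OF Dw bounded_bilinear.FDERIV[OF bounded_bilinear_matrix_vector_mult DM Dw]])
    qed
    from mvt_simple[OF s0 this] obtain r where r: "0 < r" "r < s" and eq: "\<phi> s - \<phi> 0 = \<phi>' r s" by auto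
    have "\<phi>' r s = s * \<phi>' r 1"
    proof -
      have "M' (y + r *\<^sub>R g y, a + r) (s *\<^sub>R (g y, 1)) = s *\<^sub>R M' (y + r *\<^sub>R g y, a + r) (g y, 1)"
        by (rule linear_scale[OF linM']) (use r a in auto)
      then show ?thesis
        by (simp add: \<phi>'_def matrix_vector_mult_scaleR inner_add_right algebra_simps flip: scaleR_matrix_vector_assoc)
    qed
    moreover have "\<phi>' r 1 + 2 * \<alpha> * (v \<bullet> (M y a *v v)) = \<Psi> (y, a, r, v)"
      by (simp add: \<phi>'_def \<Psi>_def Z_def W_def inner_add_right)
    moreover have "\<Psi> (y, a, r, v) \<le> \<eta>"
    proof -
      have "dist (\<Psi> (y, a, r, v)) (\<Psi> (y, \<tau>, 0, v)) < \<eta>"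
      proof (rule \<delta>(2))
        have "dist (y, a, r, v) (y, \<tau>, 0 :: real, v) = sqrt ((dist a \<tau>)\<^sup>2 + r\<^sup>2)"
          by (simp add: dist_Pair_Pair)
        also have "\<dots> \<le> dist a \<tau> + r" using r by (intro sqrt_sum_squares_le_sum) auto
        also have "\<dots> < \<delta>" using r a s by (simp add: dist_real_def)
        finally show "dist (y, a, r, v) (y, \<tau>, 0, v) < \<delta>" .
      qed (use a r s y v \<tau> in \<open>auto simp: X_def\<close>)
      moreover have "\<Psi> (y, \<tau>, 0, v) \<le> 0"
        using contraction_quadratic_le[OF contr[of y, unfolded M_def] \<tau> D[of "(y, \<tau>)", unfolded M_def], of v] \<tau>
        by (simp add: \<Psi>_def Z_def W_def M_def A_def g_def)
      ultimately show ?thesis by (simp add: dist_real_def)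
    qed
    ultimately have "\<phi> s - \<phi> 0 \<le> s * (\<eta> - 2 * \<alpha> * (v \<bullet> (M y a *v v)))"
      using s0 eq by (simp add: mult_left_mono)
    then show ?thesis by (simp add: \<phi>_def algebra_simps)
  qed
  show ?thesis
  proof (intro exI[of _ "min 1 (\<delta> / 2)"] conjI allI impI)
    fix a s :: real and y v :: "real^'n"
    assume *: "0 \<le> a" "a \<le> \<tau>" "\<tau> \<le> a + s" "s < min 1 (\<delta> / 2)" "y \<in> K"
    \<comment> \<open>Both sides are homogeneous of degree 2 in \<open>v\<close>, so unit vectors
      suffice; for \<open>v = 0\<close> any unit vector serves.\<close>
    define u where "u = (if v = 0 then axis undefined 1 else v /\<^sub>R norm v)"
    have u: "norm u = 1" "v = norm v *\<^sub>R u" by (auto simp: u_def)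
    have w: "v + s *\<^sub>R (A y *v v) = norm v *\<^sub>R (u + s *\<^sub>R (A y *v u))"
      by (subst (1 2) u(2)) (simp only: matrix_vector_mult_scaleR scaleR_add_right scaleR_left_commute)
    have "(norm v)\<^sup>2 * ((u + s *\<^sub>R (A y *v u)) \<bullet> (M (y + s *\<^sub>R g y) (a + s) *v (u + s *\<^sub>R (A y *v u))))
      \<le> (norm v)\<^sup>2 * ((1 - 2 * \<alpha> * s) * (u \<bullet> (M y a *v u)) + \<eta> * s)"
      by (intro mult_left_mono unit * u) simp
    moreover have "v \<bullet> (M y a *v v) = (norm v)\<^sup>2 * (u \<bullet> (M y a *v u))"
      by (subst (1 2) u(2)) (simp only: matrix_vector_mult_scaleR inner_scaleR_left inner_scaleR_right power2_eq_square mult.assoc)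
    ultimately show "(v + s *\<^sub>R (A y *v v)) \<bullet> (M (y + s *\<^sub>R g y) (a + s) *v (v + s *\<^sub>R (A y *v v)))
      \<le> (1 - 2 * \<alpha> * s) * (v \<bullet> (M y a *v v)) + \<eta> * s * (norm v)\<^sup>2"
      unfolding w by (simp add: matrix_vector_mult_scaleR power2_eq_square algebra_simps)
  qed (use \<delta>(1) in auto)
qed

lemma contracting_law_metric_factor:
  assumes "contracting_law h us \<Theta> \<alpha> mlow mup xd ud" "0 \<le> t"
  shows "metric_factor (\<lambda>y. \<Theta> y t) (sqrt mlow) (sqrt mup)"
proof
  have m: "0 < mlow" "0 < mup" and ck: "Ck_on 1 (UNIV \<times> {0..}) (\<lambda>(y, t). metric \<Theta> y t)"
    and le: "mlow *\<^sub>R mat 1 \<preceq> metric \<Theta> y t" "metric \<Theta> y t \<preceq> mup *\<^sub>R mat 1" for y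
    using assms unfolding contracting_law_def by blast+
  have nsq: "(norm (\<Theta> y t *v v))\<^sup>2 = v \<bullet> (metric \<Theta> y t *v v)" for y v
    by (simp add: metric_def norm_mult_vec_sq)
  from Ck_on_1_slice[OF ck assms(2)] obtain M' where
    D: "\<And>z. z \<in> UNIV \<Longrightarrow> ((\<lambda>y. metric \<Theta> y t) has_derivative M' z) (at z within UNIV)"
    by (rule Ck_on_1E) blast
  show "continuous_on UNIV (\<lambda>y. transpose (\<Theta> y t) ** \<Theta> y t)"
    using has_derivative_continuous_on[OF D] by (simp add: metric_def)
  show "0 < sqrt mlow" using m by simp
  fix v y
  have "0 \<le> v \<bullet> ((metric \<Theta> y t - mlow *\<^sub>R mat 1) *v v)" "0 \<le> v \<bullet> ((mup *\<^sub>R mat 1 - metric \<Theta> y t) *v v)"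
    using le[of y] unfolding loewner_le_def psd_def by blast+
  then have "mlow * (norm v)\<^sup>2 \<le> (norm (\<Theta> y t *v v))\<^sup>2" "(norm (\<Theta> y t *v v))\<^sup>2 \<le> mup * (norm v)\<^sup>2"
    by (simp_all add: matrix_vector_mult_diff_rdistrib inner_diff_right nsq power2_norm_eq_inner[of v]
        flip: scaleR_matrix_vector_assoc)
  then have "(sqrt mlow * norm v)\<^sup>2 \<le> (norm (\<Theta> y t *v v))\<^sup>2" "(norm (\<Theta> y t *v v))\<^sup>2 \<le> (sqrt mup * norm v)\<^sup>2"
    using m by (simp_all add: power_mult_distrib)
  then show "sqrt mlow * norm v \<le> norm (\<Theta> y t *v v)" "norm (\<Theta> y t *v v) \<le> sqrt mup * norm v"
    using m by (auto intro: power2_le_imp_le)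
qed

text \<open>The quadratic estimate is applied to each velocity vector, its square root taken, and
  the result integrated along the curve. One \<open>\<delta>\<close> serves all curves in
  \<open>K\<close>, as needed because the nearly shortest curve varies with
  \<open>a\<close>.\<close>

lemma contraction_push_length:
  fixes us :: "real^'n \<Rightarrow> real^'n \<Rightarrow> real^'m \<Rightarrow> real \<Rightarrow> real^'m" and K :: "(real^'n) set"
  assumes law: "contracting_law h us \<Theta> \<alpha> mlow mup xd ud"
    and g: "Ck_on 1 UNIV g" and g_def: "g = (\<lambda>y. h y (us y (xd \<tau>) (ud \<tau>) \<tau>) \<tau>)"
    and \<tau>: "0 \<le> \<tau>" and K: "compact K" and e: "0 < e"
  shows "\<exists>\<delta>>0. \<forall>a s \<gamma> p p'. 0 \<le> a \<longrightarrow> a \<le> \<tau> \<longrightarrow> \<tau> \<le> a + s \<longrightarrow> s < \<delta> \<longrightarrow>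
    C1_path \<gamma> p p' \<longrightarrow> \<gamma> ` {0..1} \<subseteq> K \<longrightarrow>
    C1_path (\<lambda>r. \<gamma> r + s *\<^sub>R g (\<gamma> r)) (p + s *\<^sub>R g p) (p' + s *\<^sub>R g p') \<and>
    weighted_length_int (\<lambda>y. \<Theta> y (a + s)) (\<lambda>r. \<gamma> r + s *\<^sub>R g (\<gamma> r))
      \<le> (1 - \<alpha> * s + e * s) * weighted_length_int (\<lambda>y. \<Theta> y a) \<gamma>"
proof -
  let ?A = "\<lambda>y. jacobian g (at y)"
  have \<alpha>: "0 < \<alpha>" and m: "0 < mlow" and ck: "Ck_on 1 (UNIV \<times> {0..}) (\<lambda>(y, t). metric \<Theta> y t)"
    and contr: "contraction_mat h (metric \<Theta>) \<alpha> (\<lambda>y. us y (xd \<tau>) (ud \<tau>) \<tau>) y \<tau> \<preceq> 0" for y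
    using law \<tau> unfolding contracting_law_def by blast+
  \<comment> \<open>With this \<open>\<eta>\<close>, the lower metric bound absorbs the error
    \<open>\<eta> * s * (norm v)\<^sup>2\<close> into \<open>2 * e * s\<close> times the quadratic
    form.\<close>
  have "0 < 2 * e * mlow" using e m by simp
  from contraction_push_quadratic[of \<Theta> h "\<lambda>y. us y (xd \<tau>) (ud \<tau>) \<tau>", OF ck _ contr \<tau> K this] g
  obtain \<delta> where \<delta>: "0 < \<delta>" and quad: "\<And>a s y v. 0 \<le> a \<Longrightarrow> a \<le> \<tau> \<Longrightarrow> \<tau> \<le> a + s \<Longrightarrow> s < \<delta> \<Longrightarrow> y \<in> K \<Longrightarrow>
    (v + s *\<^sub>R (?A y *v v)) \<bullet> (metric \<Theta> (y + s *\<^sub>R g y) (a + s) *v (v + s *\<^sub>R (?A y *v v)))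
      \<le> (1 - 2 * \<alpha> * s) * (v \<bullet> (metric \<Theta> y a *v v)) + 2 * e * mlow * s * (norm v)\<^sup>2"
    unfolding g_def by blast
  show ?thesis
  \<comment> \<open>The bound \<open>1 / \<alpha>\<close> keeps the contraction factor nonnegative,
    so that comparing squares compares norms.\<close>
  proof (intro exI[of _ "min \<delta> (1 / \<alpha>)"] conjI[of "0 < _"] allI impI)
    show "0 < min \<delta> (1 / \<alpha>)" using \<delta> \<alpha> by simp
    fix a s :: real and \<gamma> :: "real \<Rightarrow> real^'n" and p p'
    assume a: "0 \<le> a" "a \<le> \<tau>" "\<tau> \<le> a + s" and s: "s < min \<delta> (1 / \<alpha>)"
      and \<gamma>: "C1_path \<gamma> p p'" and \<gamma>K: "\<gamma> ` {0..1} \<subseteq> K"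
    have s0: "0 \<le> s" and b: "0 \<le> a + s" using a by auto
    interpret A: metric_factor "\<lambda>y. \<Theta> y a" "sqrt mlow" "sqrt mup"
      using law a(1) by (rule contracting_law_metric_factor)
    interpret B: metric_factor "\<lambda>y. \<Theta> y (a + s)" "sqrt mlow" "sqrt mup"
      using law b by (rule contracting_law_metric_factor)
    let ?\<rho> = "1 - \<alpha> * s + e * s"
    have "\<alpha> * s \<le> 1" using s \<alpha> by (simp add: field_simps)
    then have \<rho>: "0 \<le> ?\<rho>" using e s0 by (simp add: add_nonneg_nonneg)
    have pt: "norm (\<Theta> (y + s *\<^sub>R g y) (a + s) *v (v + s *\<^sub>R (?A y *v v))) \<le> ?\<rho> * norm (\<Theta> y a *v v)"
      if "y \<in> K" for y v
    proof (rule power2_le_imp_le)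
      let ?N = "(norm (\<Theta> y a *v v))\<^sup>2"
      have "(sqrt mlow * norm v)\<^sup>2 \<le> ?N" by (rule power_mono[OF A.lower]) (use m in simp)
      then have "mlow * (norm v)\<^sup>2 \<le> ?N" using m by (simp add: power_mult_distrib)
      then have "2 * e * s * (mlow * (norm v)\<^sup>2) \<le> 2 * e * s * ?N"
        using e s0 by (intro mult_left_mono) auto
      moreover have "(norm (\<Theta> (y + s *\<^sub>R g y) (a + s) *v (v + s *\<^sub>R (?A y *v v))))\<^sup>2
          \<le> (1 - 2 * \<alpha> * s) * ?N + 2 * e * mlow * s * (norm v)\<^sup>2"
        using quad[OF a _ that, of v] s by (simp add: norm_mult_vec_sq metric_def)
      ultimately have "(norm (\<Theta> (y + s *\<^sub>R g y) (a + s) *v (v + s *\<^sub>R (?A y *v v))))\<^sup>2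
          \<le> (1 - 2 * \<alpha> * s + 2 * e * s) * ?N" by (simp add: algebra_simps)
      also have "\<dots> \<le> ?\<rho>\<^sup>2 * ?N"
      proof (rule mult_right_mono)
        have "0 \<le> (e * s - \<alpha> * s)\<^sup>2" by simp
        then show "1 - 2 * \<alpha> * s + 2 * e * s \<le> ?\<rho>\<^sup>2" by (simp add: power2_eq_square algebra_simps)
      qed simp
      finally show "(norm (\<Theta> (y + s *\<^sub>R g y) (a + s) *v (v + s *\<^sub>R (?A y *v v))))\<^sup>2
          \<le> (?\<rho> * norm (\<Theta> y a *v v))\<^sup>2" by (simp add: power_mult_distrib)
    qed (use \<rho> in simp)
    from \<gamma> obtain \<gamma>' where d: "\<And>r. r \<in> {0..1} \<Longrightarrow> (\<gamma> has_vector_derivative \<gamma>' r) (at r within {0..1})"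
      and cont: "continuous_on {0..1} \<gamma>'" and e: "\<gamma> 0 = p" "\<gamma> 1 = p'" by (rule C1_pathE) blast
    note cont\<gamma> = continuous_on_vector_derivative[OF d]
    let ?\<beta> = "\<lambda>r. \<gamma> r + s *\<^sub>R g (\<gamma> r)" and ?\<beta>' = "\<lambda>r. \<gamma>' r + s *\<^sub>R (?A (\<gamma> r) *v \<gamma>' r)"
    have d\<beta>: "(?\<beta> has_vector_derivative ?\<beta>' r) (at r within {0..1})" if "r \<in> {0..1}" for r
    proof -
      have "((\<lambda>r. g (\<gamma> r)) has_derivative (\<lambda>t. ?A (\<gamma> r) *v (t *\<^sub>R \<gamma>' r))) (at r within {0..1})"
        using has_derivative_compose[OF d[OF that, unfolded has_vector_derivative_def]
            Ck_on_1_has_derivative_jacobian(1)[OF g]] .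
      then have "((\<lambda>r. g (\<gamma> r)) has_vector_derivative ?A (\<gamma> r) *v \<gamma>' r) (at r within {0..1})"
        by (simp add: has_vector_derivative_def matrix_vector_mult_scaleR)
      then have "((\<lambda>r. s *\<^sub>R g (\<gamma> r)) has_vector_derivative s *\<^sub>R (?A (\<gamma> r) *v \<gamma>' r)) (at r within {0..1})"
        by (rule bounded_linear.has_vector_derivative[OF bounded_linear_scaleR_right])
      with d[OF that] show ?thesis by (rule has_vector_derivative_add)
    qed
    have c\<beta>': "continuous_on {0..1} ?\<beta>'"
      by (intro continuous_on_add continuous_on_scaleR continuous_on_const continuous_on_matrix_vector_mult
          cont continuous_on_compose2[OF Ck_on_1_has_derivative_jacobian(2)[OF g] cont\<gamma>]) auto
    have path: "C1_path ?\<beta> (p + s *\<^sub>R g p) (p' + s *\<^sub>R g p')"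
      by (rule C1_pathI[OF d\<beta> c\<beta>']) (simp_all add: e)
    have "weighted_length_int (\<lambda>y. \<Theta> y (a + s)) ?\<beta> = integral {0..1} (\<lambda>r. norm (\<Theta> (?\<beta> r) (a + s) *v ?\<beta>' r))"
      by (rule weighted_length_int_eq) (rule d\<beta>)
    also have "\<dots> \<le> integral {0..1} (\<lambda>r. ?\<rho> * norm (\<Theta> (\<gamma> r) a *v \<gamma>' r))"
    proof (rule integral_le)
      show "(\<lambda>r. norm (\<Theta> (?\<beta> r) (a + s) *v ?\<beta>' r)) integrable_on {0..1}"
        by (intro integrable_continuous_real B.continuous_on_weighted_norm c\<beta>'
            continuous_on_vector_derivative[OF d\<beta>])
      show "(\<lambda>r. ?\<rho> * norm (\<Theta> (\<gamma> r) a *v \<gamma>' r)) integrable_on {0..1}"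
        by (intro integrable_continuous_real continuous_on_mult continuous_on_const
            A.continuous_on_weighted_norm cont cont\<gamma>)
    qed (rule pt, use \<gamma>K in blast)
    also have "\<dots> = ?\<rho> * weighted_length_int (\<lambda>y. \<Theta> y a) \<gamma>"
      by (subst weighted_length_int_eq[OF d]) auto
    finally show "C1_path ?\<beta> (p + s *\<^sub>R g p) (p' + s *\<^sub>R g p') \<and>
        weighted_length_int (\<lambda>y. \<Theta> y (a + s)) ?\<beta> \<le> ?\<rho> * weighted_length_int (\<lambda>y. \<Theta> y a) \<gamma>"
      using path by blast
  qed
qed

section \<open>Straddling intervals and a Gronwall inequality\<close>

lemma has_vector_derivative_straddle:
  fixes x :: "real \<Rightarrow> 'a::real_normed_vector"
  assumes "(x has_vector_derivative x') (at \<tau> within S)" "0 < e" "\<tau> \<in> S"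
  shows "\<exists>\<delta>>0. \<forall>a\<in>S. \<forall>b\<in>S. a \<le> \<tau> \<longrightarrow> \<tau> \<le> b \<longrightarrow> b - a < \<delta> \<longrightarrow>
    norm (x b - x a - (b - a) *\<^sub>R x') \<le> e * (b - a)"
proof -
  from assms(1,2) obtain \<delta> where \<delta>: "0 < \<delta>"
    and *: "\<And>y. y \<in> S \<Longrightarrow> \<bar>y - \<tau>\<bar> < \<delta> \<Longrightarrow> norm (x y - x \<tau> - (y - \<tau>) *\<^sub>R x') \<le> e * \<bar>y - \<tau>\<bar>"
    unfolding has_vector_derivative_def has_derivative_within_alt real_norm_def by blast
  show ?thesis
  proof (intro exI[of _ \<delta>] conjI ballI impI \<delta>)
    fix a b assume ab: "a \<in> S" "b \<in> S" "a \<le> \<tau>" "\<tau> \<le> b" "b - a < \<delta>"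
    \<comment> \<open>Both errors are measured from \<open>\<tau>\<close>; as \<open>\<tau>\<close>
      lies between \<open>a\<close> and \<open>b\<close>, the two distances add up to exactly
      \<open>b - a\<close>.\<close>
    have "x b - x a - (b - a) *\<^sub>R x' = (x b - x \<tau> - (b - \<tau>) *\<^sub>R x') - (x a - x \<tau> - (a - \<tau>) *\<^sub>R x')"
      by (simp add: algebra_simps)
    then have "norm (x b - x a - (b - a) *\<^sub>R x') \<le>
        norm (x b - x \<tau> - (b - \<tau>) *\<^sub>R x') + norm (x a - x \<tau> - (a - \<tau>) *\<^sub>R x')"
      by (simp only: norm_triangle_ineq4)
    also have "\<dots> \<le> e * \<bar>b - \<tau>\<bar> + e * \<bar>a - \<tau>\<bar>" using ab by (intro add_mono *) auto
    also have "\<dots> = e * (b - a)" using ab by (simp add: algebra_simps)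
    finally show "norm (x b - x a - (b - a) *\<^sub>R x') \<le> e * (b - a)" .
  qed
qed

text \<open>\<open>D\<close> is merely bounded, with no continuity to rely on. After multiplication
  by the integrating factor, increments of \<open>\<phi>\<close> over short intervals around any
  point are at most an arbitrarily small multiple of their length; bisection carries this to the
  whole interval.\<close>

lemma straddle_gronwall:
  fixes D :: "real \<Rightarrow> real"
  assumes k: "k \<noteq> 0"
    and bound: "\<And>t. t \<in> {0..T} \<Longrightarrow> \<bar>D t\<bar> \<le> B"
    and straddle: "\<And>\<tau> e. \<tau> \<in> {0..T} \<Longrightarrow> 0 < e \<Longrightarrow>
      \<exists>\<delta>>0. \<forall>a\<in>{0..T}. \<forall>b\<in>{0..T}. a \<le> \<tau> \<longrightarrow> \<tau> \<le> b \<longrightarrow> b - a < \<delta> \<longrightarrow>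
        D b \<le> D a + (b - a) * (c - k * D a) + e * (b - a)"
    and t: "t \<in> {0..T}"
  shows "D t \<le> D 0 * exp (- k * t) + c / k * (1 - exp (- k * t))"
proof -
  define \<phi> where "\<phi> = (\<lambda>t. exp (k * t) * (D t - c / k))"
  \<comment> \<open>The sign of \<open>k\<close> is open, hence the absolute value in this common
    bound for the weights \<open>exp (k * t)\<close>.\<close>
  define E where "E = exp (\<bar>k\<bar> * T)"
  have E: "0 < E" "exp (k * t) \<le> E" if "t \<in> {0..T}" for t
  proof -
    have "k * t \<le> \<bar>k\<bar> * T" using that by (intro mult_mono) auto
    then show "0 < E" "exp (k * t) \<le> E" by (simp_all add: E_def)
  qed
  have E0: "0 < E" by (simp add: E_def)
  have B0: "0 \<le> B" using bound[OF t] by linarith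
  define F where "F = E * (B + \<bar>c / k\<bar>) + 1"
  have F: "0 < F" using E0 B0 by (simp add: F_def add_nonneg_pos)
  have \<phi>F: "\<bar>\<phi> t\<bar> \<le> F" if "t \<in> {0..T}" for t
  proof -
    have "\<bar>\<phi> t\<bar> = exp (k * t) * \<bar>D t - c / k\<bar>" by (simp add: \<phi>_def abs_mult)
    also have "\<dots> \<le> E * (B + \<bar>c / k\<bar>)"
      using E(2)[OF that] bound[OF that] E0
      by (intro mult_mono order_trans[OF abs_triangle_ineq4 add_right_mono]) auto
    finally show ?thesis by (simp add: F_def)
  qed
  have "\<phi> t \<le> \<phi> 0 + e" if e: "0 < e" for e
  proof -
    \<comment> \<open>The total error is \<open>e1 * t \<le> e\<close>; the summand 1 avoids a zero
      denominator for \<open>T = 0\<close>.\<close>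
    define e1 where "e1 = e / (T + 1)"
    have T: "0 \<le> T" using t by auto
    then have e1: "0 < e1" using e by (simp add: e1_def)
    have "0 \<le> t" using t by simp
    \<comment> \<open>This property is additive over adjacent intervals, as bisection requires. The
      guard is needed because the local condition also ranges over intervals leaving
      \<open>{0..T}\<close>.\<close>
    define P where "P = (\<lambda>a b. 0 \<le> a \<and> b \<le> T \<longrightarrow> \<phi> b \<le> \<phi> a + e1 * (b - a))"
    from \<open>0 \<le> t\<close> have "P 0 t"
    proof (rule Bolzano[of 0 t P])
      fix a b c assume "P a b" "P b c" "a \<le> b" "b \<le> c"
      then show "P a c" unfolding P_def by (auto simp: algebra_simps)
    next
      fix \<tau> assume "0 \<le> \<tau>" "\<tau> \<le> t"
      then have \<tau>: "\<tau> \<in> {0..T}" using t by auto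
      \<comment> \<open>Growth of the weight and linear decay cancel to first order, so this product
        is \<open>1 + o(s)\<close>.\<close>
      have "((\<lambda>s. exp (k * s) * (1 - k * s)) has_real_derivative 0) (at 0)"
        by (auto intro!: derivative_eq_intros)
      then have u: "((\<lambda>s. exp (k * s) * (1 - k * s)) has_vector_derivative 0) (at 0 within UNIV)"
        by (simp add: has_real_derivative_iff_has_vector_derivative)
      have "0 < e1 / (2 * F)" using e1 F by simp
      from has_vector_derivative_straddle[OF u this UNIV_I] obtain \<delta>1 where \<delta>1: "0 < \<delta>1"
        "\<And>s. 0 \<le> s \<Longrightarrow> s < \<delta>1 \<Longrightarrow> \<bar>exp (k * s) * (1 - k * s) - 1\<bar> \<le> e1 / (2 * F) * s"
        by (auto dest!: bspec[of UNIV _ 0])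
      have "0 < e1 / (2 * E)" using e1 E0 by simp
      from straddle[OF \<tau> this] obtain \<delta>2 where \<delta>2: "0 < \<delta>2"
        "\<And>a b. a \<in> {0..T} \<Longrightarrow> b \<in> {0..T} \<Longrightarrow> a \<le> \<tau> \<Longrightarrow> \<tau> \<le> b \<Longrightarrow> b - a < \<delta>2 \<Longrightarrow>
        D b \<le> D a + (b - a) * (c - k * D a) + e1 / (2 * E) * (b - a)" by blast
      show "\<exists>d>0. \<forall>a b. a \<le> \<tau> \<and> \<tau> \<le> b \<and> b - a < d \<longrightarrow> P a b"
        unfolding P_def
      proof (intro exI[of _ "min \<delta>1 \<delta>2"] conjI allI impI)
        show "0 < min \<delta>1 \<delta>2" using \<delta>1 \<delta>2 by simp
        fix a b assume *: "a \<le> \<tau> \<and> \<tau> \<le> b \<and> b - a < min \<delta>1 \<delta>2" "0 \<le> a \<and> b \<le> T"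
        define s where "s = b - a"
        have s: "0 \<le> s" "s < \<delta>1" "s < \<delta>2" and b: "b = a + s" using * by (auto simp: s_def)
        have aT: "a \<in> {0..T}" and bT: "b \<in> {0..T}" using * by auto
        \<comment> \<open>Subtracting the equilibrium \<open>c / k\<close> turns the affine step
          into multiplication by \<open>1 - k * s\<close>.\<close>
        have "D b - c / k \<le> (D a - c / k) * (1 - k * s) + e1 / (2 * E) * s"
        proof -
          have "(D a - c / k) * (1 - k * s) = D a - c / k + s * (c - k * D a)"
            using k by (simp add: field_simps)
          then show ?thesis using \<delta>2(2)[OF aT bT] * unfolding s_def by simp
        qed
        then have "\<phi> b \<le> exp (k * b) * ((D a - c / k) * (1 - k * s) + e1 / (2 * E) * s)"
          unfolding \<phi>_def by (rule mult_left_mono) simp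
        also have "\<dots> = \<phi> a + \<phi> a * (exp (k * s) * (1 - k * s) - 1) + exp (k * b) * (e1 / (2 * E) * s)"
          by (simp add: \<phi>_def b exp_add algebra_simps)
        also have "\<phi> a * (exp (k * s) * (1 - k * s) - 1) \<le> \<bar>\<phi> a\<bar> * \<bar>exp (k * s) * (1 - k * s) - 1\<bar>"
          by (metis abs_ge_self abs_mult)
        also have "\<dots> \<le> F * (e1 / (2 * F) * s)"
          using \<phi>F[OF aT] \<delta>1(2)[OF s(1,2)] F by (intro mult_mono) auto
        also have "exp (k * b) * (e1 / (2 * E) * s) \<le> E * (e1 / (2 * E) * s)"
          using E(2)[OF bT] e1 E0 s(1) by (intro mult_right_mono) auto
        also have "\<phi> a + F * (e1 / (2 * F) * s) + E * (e1 / (2 * E) * s) = \<phi> a + e1 * s"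
          using F E0 by (simp add: field_simps)
        finally show "\<phi> b \<le> \<phi> a + e1 * (b - a)" by (simp add: s_def)
      qed
    qed
    then have "\<phi> t \<le> \<phi> 0 + e1 * t" using t by (simp add: P_def)
    also have "e1 * t \<le> e1 * (T + 1)" using e1 t by (intro mult_left_mono) auto
    also have "\<dots> = e" using T by (simp add: e1_def)
    finally show ?thesis by simp
  qed
  then have "\<phi> t \<le> \<phi> 0" by (rule field_le_epsilon)
  then have "exp (- k * t) * \<phi> t \<le> exp (- k * t) * \<phi> 0" by (rule mult_left_mono) simp
  moreover have "exp (- k * t) * \<phi> t = D t - c / k"
    by (simp add: \<phi>_def flip: mult.assoc exp_add)
  ultimately show ?thesis by (simp add: \<phi>_def algebra_simps)
qed

text \<open>A difference form of \<open>D' \<le> sqrt mup * norm v - \<alpha> * D\<close>. The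
  infimum need not be attained, so a curve of nearly minimal length at time \<open>a\<close> is
  pushed, and \<open>geodesic_dist_perturb\<close> pays for the gap between its pushed end points
  and the true ones at time \<open>b\<close>.\<close>

lemma geodesic_dist_straddle:
  fixes us :: "real^'n \<Rightarrow> real^'n \<Rightarrow> real^'m \<Rightarrow> real \<Rightarrow> real^'m" and x xd :: "real \<Rightarrow> real^'n"
  assumes law: "contracting_law h us \<Theta> \<alpha> mlow mup xd ud"
    and g: "Ck_on 1 UNIV g" and g_def: "g = (\<lambda>y. h y (us y (xd \<tau>) (ud \<tau>) \<tau>) \<tau>)"
    and \<tau>: "\<tau> \<in> {0..T}" and e: "0 < e"
    and xd: "(xd has_vector_derivative g (xd \<tau>)) (at \<tau> within {0..T})"
    and x: "(x has_vector_derivative g (x \<tau>) + v) (at \<tau> within {0..T})"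
    and R: "\<And>t. t \<in> {0..T} \<Longrightarrow> norm (xd t) \<le> R"
    and DB: "\<And>t. t \<in> {0..T} \<Longrightarrow> geodesic_dist (\<lambda>y. \<Theta> y t) (xd t) (x t) \<le> DB"
  shows "\<exists>\<delta>>0. \<forall>a\<in>{0..T}. \<forall>b\<in>{0..T}. a \<le> \<tau> \<longrightarrow> \<tau> \<le> b \<longrightarrow> b - a < \<delta> \<longrightarrow>
    geodesic_dist (\<lambda>y. \<Theta> y b) (xd b) (x b) \<le> geodesic_dist (\<lambda>y. \<Theta> y a) (xd a) (x a)
      + (b - a) * (sqrt mup * norm v - \<alpha> * geodesic_dist (\<lambda>y. \<Theta> y a) (xd a) (x a)) + e * (b - a)"
proof -
  define D where "D = (\<lambda>t. geodesic_dist (\<lambda>y. \<Theta> y t) (xd t) (x t))"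
  define c C where "c = sqrt mlow" and "C = sqrt mup"
  have \<alpha>: "0 < \<alpha>" and c: "0 < c" and C: "0 < C" using law unfolding contracting_law_def c_def C_def by auto
  have mf: "metric_factor (\<lambda>y. \<Theta> y t) c C" if "0 \<le> t" for t
    unfolding c_def C_def using law that by (rule contracting_law_metric_factor)
  \<comment> \<open>The curves to be pushed start within \<open>R\<close> of the origin and have
    length at most \<open>(DB + 1) / c\<close>; the 1 covers their excess over the infimum.\<close>
  define K where "K = cball (0 :: real^'n) (R + (DB + 1) / c)"
  \<comment> \<open>\<open>4 * C\<close> accounts for four end point errors of size
    \<open>e1 * s\<close>, two at each end, and \<open>\<bar>DB\<bar>\<close> for the loss
    \<open>e1 * s\<close> in the contraction factor.\<close>
  define e1 where "e1 = e / (\<bar>DB\<bar> + 4 * C + 1)"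
  have e1: "0 < e1" using e C by (simp add: e1_def add_nonneg_pos)
  have e1': "e1 * (\<bar>DB\<bar> + 4 * C) \<le> e" using e C by (simp add: e1_def field_simps)
  have \<tau>0: "0 \<le> \<tau>" using \<tau> by simp
  have "compact K" by (simp add: K_def)
  from contraction_push_length[OF law g g_def \<tau>0 this e1] obtain \<delta>1 where \<delta>1: "0 < \<delta>1"
    and push: "\<And>a s \<gamma> p p'. 0 \<le> a \<Longrightarrow> a \<le> \<tau> \<Longrightarrow> \<tau> \<le> a + s \<Longrightarrow> s < \<delta>1 \<Longrightarrow> C1_path \<gamma> p p' \<Longrightarrow> \<gamma> ` {0..1} \<subseteq> K \<Longrightarrow>
    C1_path (\<lambda>r. \<gamma> r + s *\<^sub>R g (\<gamma> r)) (p + s *\<^sub>R g p) (p' + s *\<^sub>R g p') \<and>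
    weighted_length_int (\<lambda>y. \<Theta> y (a + s)) (\<lambda>r. \<gamma> r + s *\<^sub>R g (\<gamma> r))
      \<le> (1 - \<alpha> * s + e1 * s) * weighted_length_int (\<lambda>y. \<Theta> y a) \<gamma>" by blast
  from has_vector_derivative_straddle[OF xd e1 \<tau>] obtain \<delta>2 where \<delta>2: "0 < \<delta>2"
    and xd_straddle: "\<And>a b. a \<in> {0..T} \<Longrightarrow> b \<in> {0..T} \<Longrightarrow> a \<le> \<tau> \<Longrightarrow> \<tau> \<le> b \<Longrightarrow> b - a < \<delta>2 \<Longrightarrow>
      norm (xd b - xd a - (b - a) *\<^sub>R g (xd \<tau>)) \<le> e1 * (b - a)" by blast
  from has_vector_derivative_straddle[OF x e1 \<tau>] obtain \<delta>3 where \<delta>3: "0 < \<delta>3"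
    and x_straddle: "\<And>a b. a \<in> {0..T} \<Longrightarrow> b \<in> {0..T} \<Longrightarrow> a \<le> \<tau> \<Longrightarrow> \<tau> \<le> b \<Longrightarrow> b - a < \<delta>3 \<Longrightarrow>
      norm (x b - x a - (b - a) *\<^sub>R (g (x \<tau>) + v)) \<le> e1 * (b - a)" by blast
  \<comment> \<open>The push moves the end points by \<open>g\<close> at their positions at time
    \<open>a\<close>, while the derivatives involve \<open>g\<close> at the positions at
    \<open>\<tau>\<close>; continuity bridges the two.\<close>
  have cont: "\<exists>d>0. \<forall>a\<in>{0..T}. \<bar>a - \<tau>\<bar> < d \<longrightarrow> norm (g (z \<tau>) - g (z a)) \<le> e1"
    if "(z has_vector_derivative z') (at \<tau> within {0..T})" for z z'
  proof -
    have "(z \<longlongrightarrow> z \<tau>) (at \<tau> within {0..T})"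
      using has_vector_derivative_continuous[OF that] by (simp add: continuous_within)
    moreover have "isCont g (z \<tau>)"
      using has_derivative_continuous[OF Ck_on_1_has_derivative_jacobian(1)[OF g]] .
    ultimately have "continuous (at \<tau> within {0..T}) (\<lambda>a. g (z a))"
      by (simp add: continuous_within isCont_tendsto_compose)
    then obtain d where "0 < d" "\<And>a. a \<in> {0..T} \<Longrightarrow> dist a \<tau> < d \<Longrightarrow> dist (g (z a)) (g (z \<tau>)) < e1"
      unfolding continuous_within_eps_delta using e1 by blast
    then show ?thesis by (intro exI[of _ d]) (force simp: dist_norm norm_minus_commute)
  qed
  from cont[OF xd] obtain \<delta>4 where \<delta>4: "0 < \<delta>4"
    and xd_cont: "\<And>a. a \<in> {0..T} \<Longrightarrow> \<bar>a - \<tau>\<bar> < \<delta>4 \<Longrightarrow> norm (g (xd \<tau>) - g (xd a)) \<le> e1" by blast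
  from cont[OF x] obtain \<delta>5 where \<delta>5: "0 < \<delta>5"
    and x_cont: "\<And>a. a \<in> {0..T} \<Longrightarrow> \<bar>a - \<tau>\<bar> < \<delta>5 \<Longrightarrow> norm (g (x \<tau>) - g (x a)) \<le> e1" by blast
  define \<delta> where "\<delta> = Min {\<delta>1, \<delta>2, \<delta>3, \<delta>4, \<delta>5, 1 / \<alpha>}"
  show ?thesis
    unfolding D_def[THEN fun_cong, symmetric] C_def[symmetric]
  proof (intro exI[of _ \<delta>] conjI ballI impI)
    show "0 < \<delta>" using \<delta>1 \<delta>2 \<delta>3 \<delta>4 \<delta>5 \<alpha> by (simp add: \<delta>_def)
    fix a b assume a: "a \<in> {0..T}" and b: "b \<in> {0..T}" and ab: "a \<le> \<tau>" "\<tau> \<le> b" "b - a < \<delta>"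
    define s where "s = b - a"
    have s: "0 \<le> s" "s < \<delta>1" "s < \<delta>2" "s < \<delta>3" "s < \<delta>4" "s < \<delta>5" "s < 1 / \<alpha>" "b = a + s"
      using ab by (auto simp: s_def \<delta>_def)
    interpret A: metric_factor "\<lambda>y. \<Theta> y a" c C by (rule mf) (use a in simp)
    interpret B: metric_factor "\<lambda>y. \<Theta> y b" c C by (rule mf) (use b in simp)
    define \<rho> where "\<rho> = 1 - \<alpha> * s + e1 * s"
    have "\<alpha> * s \<le> 1" using s \<alpha> by (simp add: field_simps)
    then have \<rho>: "0 \<le> \<rho>" using e1 s(1) by (simp add: \<rho>_def)
    have near: "D b \<le> \<rho> * (D a + \<kappa>) + C * (4 * e1 * s + s * norm v)" if \<kappa>: "0 < \<kappa>" "\<kappa> < 1" for \<kappa>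
    proof -
      obtain \<gamma> where \<gamma>: "C1_path \<gamma> (xd a) (x a)" and L: "weighted_length_int (\<lambda>y. \<Theta> y a) \<gamma> < D a + \<kappa>"
        unfolding D_def by (rule A.near_geodesic[OF \<kappa>(1), of "xd a" "x a"])
      have "c * length_int \<gamma> \<le> DB + 1"
        using A.weighted_length_int_lower[OF \<gamma>] L DB[OF a] \<kappa> by (simp add: D_def)
      then have len: "length_int \<gamma> \<le> (DB + 1) / c" using c by (simp add: field_simps)
      have "\<gamma> r \<in> K" if "r \<in> {0..1}" for r
      proof -
        have "norm (\<gamma> r) \<le> norm (xd a) + norm (\<gamma> r - xd a)" by (rule norm_triangle_sub)
        then show ?thesis
          using norm_path_diff_le_length_int[OF \<gamma> that] len R[OF a] by (simp add: K_def)
      qed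
      then have "\<gamma> ` {0..1} \<subseteq> K" by blast
      from push[OF _ ab(1) _ s(2) \<gamma> this] a ab(2) s(8)
      have path: "C1_path (\<lambda>r. \<gamma> r + s *\<^sub>R g (\<gamma> r)) (xd a + s *\<^sub>R g (xd a)) (x a + s *\<^sub>R g (x a))"
        and pushed: "weighted_length_int (\<lambda>y. \<Theta> y b) (\<lambda>r. \<gamma> r + s *\<^sub>R g (\<gamma> r))
          \<le> \<rho> * weighted_length_int (\<lambda>y. \<Theta> y a) \<gamma>"
        by (simp_all add: \<rho>_def)
      have a\<tau>: "\<bar>a - \<tau>\<bar> < \<delta>4" "\<bar>a - \<tau>\<bar> < \<delta>5" using ab s by auto
      have "xd b - (xd a + s *\<^sub>R g (xd a)) = (xd b - xd a - s *\<^sub>R g (xd \<tau>)) + s *\<^sub>R (g (xd \<tau>) - g (xd a))"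
        by (simp add: algebra_simps)
      also have "norm \<dots> \<le> e1 * s + s * e1"
        using xd_straddle[OF a b ab(1,2), folded s_def] xd_cont[OF a a\<tau>(1)] s(1,3,4)
        by (intro norm_triangle_le add_mono) (simp_all add: mult_left_mono)
      finally have 1: "norm (xd b - (xd a + s *\<^sub>R g (xd a))) \<le> 2 * e1 * s" by simp
      have "x b - (x a + s *\<^sub>R g (x a)) = (x b - x a - s *\<^sub>R (g (x \<tau>) + v)) + (s *\<^sub>R (g (x \<tau>) - g (x a)) + s *\<^sub>R v)"
        by (simp add: algebra_simps)
      also have "norm \<dots> \<le> e1 * s + (s * e1 + s * norm v)"
        using x_straddle[OF a b ab(1,2), folded s_def] x_cont[OF a a\<tau>(2)] s(1,3,4)
        by (intro norm_triangle_le add_mono) (simp_all add: mult_left_mono)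
      finally have 2: "norm (x b - (x a + s *\<^sub>R g (x a))) \<le> 2 * e1 * s + s * norm v" by simp
      have "D b \<le> weighted_length_int (\<lambda>y. \<Theta> y b) (\<lambda>r. \<gamma> r + s *\<^sub>R g (\<gamma> r))
          + C * (norm (xd b - (xd a + s *\<^sub>R g (xd a))) + norm (x b - (x a + s *\<^sub>R g (x a))))"
        unfolding D_def by (rule B.geodesic_dist_perturb[OF path])
      also have "\<dots> \<le> \<rho> * (D a + \<kappa>) + C * (4 * e1 * s + s * norm v)"
      proof (rule add_mono)
        show "weighted_length_int (\<lambda>y. \<Theta> y b) (\<lambda>r. \<gamma> r + s *\<^sub>R g (\<gamma> r)) \<le> \<rho> * (D a + \<kappa>)"
          using L by (intro order_trans[OF pushed] mult_left_mono \<rho>) simp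
      qed (intro mult_left_mono, use 1 2 C in simp_all)
      finally show ?thesis .
    qed
    have "D b \<le> \<rho> * D a + C * (4 * e1 * s + s * norm v)"
    proof (rule field_le_epsilon)
      fix \<epsilon> :: real assume \<epsilon>: "0 < \<epsilon>"
      \<comment> \<open>The excess length is removed in the limit: this choice gives
        \<open>\<rho> * \<kappa> \<le> \<epsilon>\<close>, also when \<open>\<rho>\<close>
        vanishes.\<close>
      define \<kappa> where "\<kappa> = min (1 / 2) (\<epsilon> / (\<rho> + 1))"
      have "\<rho> * \<kappa> \<le> (\<rho> + 1) * (\<epsilon> / (\<rho> + 1))"
        using \<rho> \<epsilon> by (intro mult_mono) (auto simp: \<kappa>_def)
      then have "\<rho> * \<kappa> \<le> \<epsilon>" using \<rho> by simp
      moreover have "0 < \<kappa>" "\<kappa> < 1" using \<rho> \<epsilon> by (auto simp: \<kappa>_def)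
      ultimately show "D b \<le> \<rho> * D a + C * (4 * e1 * s + s * norm v) + \<epsilon>"
        using near[of \<kappa>] by (simp add: distrib_left)
    qed
    also have "\<dots> = D a + s * (C * norm v - \<alpha> * D a) + s * (e1 * (D a + 4 * C))"
      by (simp add: \<rho>_def algebra_simps)
    also have "s * (e1 * (D a + 4 * C)) \<le> s * (e1 * (\<bar>DB\<bar> + 4 * C))"
      using DB[OF a] e1 s(1) by (intro mult_left_mono) (auto simp: D_def)
    also have "\<dots> \<le> s * e" using e1' s(1) by (rule mult_left_mono)
    finally show "D b \<le> D a + (b - a) * (C * norm v - \<alpha> * D a) + e * (b - a)"
      by (simp add: s_def mult.commute)
  qed
qed

section \<open>From the one-step estimate to the exponential bound\<close>

theorem theorem6:
  fixes f :: "real^'n \<Rightarrow> real \<Rightarrow> real^'n"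
    and B :: "real^'n \<Rightarrow> real \<Rightarrow> real^'m^'n"
    and Bp :: "real^'n \<Rightarrow> real \<Rightarrow> real^'k^'n"
    and d :: "real^'n \<Rightarrow> real \<Rightarrow> real^'n"
    and us uL :: "real^'n \<Rightarrow> real^'n \<Rightarrow> real^'m \<Rightarrow> real \<Rightarrow> real^'m"
    and \<Theta> :: "real^'n \<Rightarrow> real \<Rightarrow> real^'n^'n"
    and Sx :: "(real^'n) set" and Su :: "(real^'m) set" and St :: "real set"
    and P :: "'w measure"
    and \<xi> :: "nat \<Rightarrow> 'w \<Rightarrow> (real^'n) \<times> (real^'n) \<times> (real^'m) \<times> real"
    and p :: "nat \<Rightarrow> 'w \<Rightarrow> real^'n" and p' :: "nat \<Rightarrow> 'w \<Rightarrow> real^'k"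
    and N K :: nat and \<omega> :: 'w
    and \<sigma>u \<sigma>w :: "nat \<Rightarrow> real \<Rightarrow> real"
    and outu :: "'m \<Rightarrow> nat" and outw :: "'n \<Rightarrow> 'n \<Rightarrow> nat"
    and Pu :: "((real^'n) \<times> (real^'n) \<times> (real^'m) \<times> real) nn_param set"
    and Pw :: "((real^'n) \<times> real) nn_param set"
    and \<theta>u :: "((real^'n) \<times> (real^'n) \<times> (real^'m) \<times> real) nn_param"
    and \<theta>w :: "'n metric_param"
    and x xd :: "real \<Rightarrow> real^'n" and ud :: "real \<Rightarrow> real^'m"
    and q :: "real \<Rightarrow> real \<Rightarrow> real^'n"
    and \<alpha> \<alpha>l mlow mup dbar Lu \<epsilon>0 \<epsilon>1 T :: real
  defines "h \<equiv> ctrl_affine f B"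
    and "S \<equiv> Sx \<times> Sx \<times> Su \<times> St"
  assumes f_smooth: "smooth_on (UNIV \<times> {0..}) (\<lambda>(y, t). f y t)"
    and B_smooth: "smooth_on (UNIV \<times> {0..}) (\<lambda>(y, t). B y t)"
    and d_bounded: "bdd_above ((\<lambda>(y, t). norm (d y t)) ` (UNIV \<times> {0..}))"
    and dbar: "dbar = (SUP (y, t)\<in>UNIV \<times> {0..}. norm (d y t))"
    and target: "target_trajectory h us xd ud"
    and contracting: "contracting_law h us \<Theta> \<alpha> mlow mup xd ud"
    and S_compact: "compact Sx" "compact Su" "compact St" and St_nonneg: "St \<subseteq> {0..}"
    and annihilator: "\<And>y t. 0 \<le> t \<Longrightarrow> transpose (Bp y t) ** B y t = 0"
    and P: "prob_space P"
    and N_pos: "0 < N" and K_pos: "0 < K"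
    and samples_indep: "prob_space.indep_vars P (\<lambda>_. borel) \<xi> {..<N}"
    and samples_uniform: "\<And>i. i < N \<Longrightarrow> distr P borel (\<xi> i) = uniform_measure lborel S"
    and unit_random: "\<And>i. i < K \<Longrightarrow> p i \<in> borel_measurable P \<and> p' i \<in> borel_measurable P"
    and unit: "\<And>i w. i < K \<Longrightarrow> w \<in> space P \<Longrightarrow> norm (p i w) = 1 \<and> norm (p' i w) = 1"
    and \<omega>: "\<omega> \<in> space P"
    and learned: "is_arg_min
          (\<lambda>(\<theta>u, \<theta>w). empirical_loss f B Bp \<alpha> N (\<lambda>i. \<xi> i \<omega>) K (\<lambda>i. p i \<omega>) (\<lambda>i. p' i \<omega>)
             (nn_controller \<sigma>u outu \<theta>u) (W_net \<sigma>w outw \<theta>w) (snd (snd \<theta>w)))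
          (\<lambda>(\<theta>u, (\<theta>, m_up, m_low)). \<theta>u \<in> Pu \<and> \<theta> \<in> Pw \<and> 0 < m_up \<and> m_low \<noteq> 0)
          (\<theta>u, \<theta>w)"
    and uL: "uL = nn_controller \<sigma>u outu \<theta>u"
    and A1: "\<And>y yd vd t \<gamma>. (y, yd, vd, t) \<in> S \<Longrightarrow> C1_path \<gamma> yd y \<Longrightarrow>
          norm (uL y yd vd t - us y yd vd t) \<le> \<epsilon>0 + \<epsilon>1 * length_int \<gamma>"
    and Lu_nonneg: "0 \<le> Lu"
    and A2: "\<And>y v v' t. y \<in> Sx \<Longrightarrow> t \<in> St \<Longrightarrow> norm (h y v t - h y v' t) \<le> Lu * norm (v - v')"
    and T_nonneg: "0 \<le> T"
    and closed_loop: "\<And>t. t \<in> {0..T} \<Longrightarrow>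
          (x has_vector_derivative
             f (x t) t + B (x t) t *v uL (x t) (xd t) (ud t) t + d (x t) t) (at t within {0..T})"
    and in_S: "\<And>t. t \<in> {0..T} \<Longrightarrow> (x t, xd t, ud t, t) \<in> S"
    and virtual: "virtual_family h d us uL x xd ud T q"
    and \<alpha>l: "\<alpha>l = \<alpha> - Lu * \<epsilon>1 * sqrt (mup / mlow)" and \<alpha>l_nonzero: "\<alpha>l \<noteq> 0"
  shows "\<forall>t\<in>{0..T}. norm (x t - xd t) \<le>
           norm (V_ell \<Theta> q 0) / sqrt mlow * exp (- \<alpha>l * t)
           + (Lu * \<epsilon>0 + dbar) / \<alpha>l * sqrt (mup / mlow) * (1 - exp (- \<alpha>l * t))"
proof -
  define c C where "c = sqrt mlow" and "C = sqrt mup"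
  have m: "0 < mlow" "0 < mup" using contracting unfolding contracting_law_def by auto
  then have c: "0 < c" and C: "0 < C" by (auto simp: c_def C_def)
  have mf: "metric_factor (\<lambda>y. \<Theta> y t) c C" if "0 \<le> t" for t
    unfolding c_def C_def using contracting that by (rule contracting_law_metric_factor)
  define g where "g = (\<lambda>\<tau> y. h y (us y (xd \<tau>) (ud \<tau>) \<tau>) \<tau>)"
  have g: "Ck_on 1 UNIV (g \<tau>)" if "0 \<le> \<tau>" for \<tau>
  proof -
    have "Ck_on 1 UNIV (\<lambda>y. f y \<tau>)" "Ck_on 1 UNIV (\<lambda>y. B y \<tau>)"
      using f_smooth B_smooth that unfolding smooth_on_def by (blast intro: Ck_on_1_slice)+
    moreover have "Ck_on 1 UNIV (\<lambda>y. us y (xd \<tau>) (ud \<tau>) \<tau>)"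
      using contracting that unfolding contracting_law_def by blast
    ultimately show ?thesis
      unfolding g_def h_def ctrl_affine_def by (rule Ck_on_1_matrix_vector_mult)
  qed
  have mem: "x t \<in> Sx" "xd t \<in> Sx" "ud t \<in> Su" "t \<in> St" if "t \<in> {0..T}" for t
    using in_S[OF that] by (auto simp: S_def)
  have dbar_le: "norm (d y t) \<le> dbar" if "0 \<le> t" for y t
    using cSUP_upper[OF _ d_bounded, of "(y, t)"] that by (simp add: dbar)
  \<comment> \<open>\<open>A1\<close> holds for every curve joining the points. If
    \<open>\<epsilon>1\<close> were negative, a long curve would make its right side negative; the
    state at time 0 supplies a point of \<open>S\<close>.\<close>
  have \<epsilon>1: "0 \<le> \<epsilon>1"
  proof (rule ccontr)
    assume "\<not> 0 \<le> \<epsilon>1"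
    then have neg: "\<epsilon>1 < 0" by simp
    have "0 \<in> {0..T}" using T_nonneg by simp
    note S0 = in_S[OF this]
    obtain \<gamma> where \<gamma>: "C1_path \<gamma> (xd 0) (x 0)" and L: "(\<bar>\<epsilon>0\<bar> + 1) / (- \<epsilon>1) \<le> length_int \<gamma>"
      by (rule exists_long_C1_path)
    from L neg have "\<epsilon>0 + \<epsilon>1 * length_int \<gamma> < 0" by (simp add: field_simps)
    with A1[OF S0 \<gamma>] norm_ge_zero[of "uL (x 0) (xd 0) (ud 0) 0 - us (x 0) (xd 0) (ud 0) 0"]
    show False by linarith
  qed
  \<comment> \<open>The deviation of \<open>x\<close> from the undisturbed closed loop: learning
    error plus external disturbance.\<close>
  define v where "v = (\<lambda>\<tau>. h (x \<tau>) (uL (x \<tau>) (xd \<tau>) (ud \<tau>) \<tau>) \<tau> - g \<tau> (x \<tau>) + d (x \<tau>) \<tau>)"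
  have v: "norm (v \<tau>) \<le> Lu * \<epsilon>0 + dbar + Lu * \<epsilon>1 * norm (x \<tau> - xd \<tau>)" if \<tau>: "\<tau> \<in> {0..T}" for \<tau>
  proof -
    have "norm (v \<tau>) \<le> norm (h (x \<tau>) (uL (x \<tau>) (xd \<tau>) (ud \<tau>) \<tau>) \<tau> - g \<tau> (x \<tau>)) + norm (d (x \<tau>) \<tau>)"
      unfolding v_def by (rule norm_triangle_ineq)
    also have "norm (h (x \<tau>) (uL (x \<tau>) (xd \<tau>) (ud \<tau>) \<tau>) \<tau> - g \<tau> (x \<tau>))
        \<le> Lu * norm (uL (x \<tau>) (xd \<tau>) (ud \<tau>) \<tau> - us (x \<tau>) (xd \<tau>) (ud \<tau>) \<tau>)"
      unfolding g_def by (rule A2) (use mem[OF \<tau>] in auto)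
    \<comment> \<open>On the straight segment, the length in \<open>A1\<close> becomes the Euclidean
      distance.\<close>
    also have "\<dots> \<le> Lu * (\<epsilon>0 + \<epsilon>1 * norm (x \<tau> - xd \<tau>))"
      using A1[OF in_S[OF \<tau>] C1_path_linepath] Lu_nonneg
      by (intro mult_left_mono) (simp_all add: length_int_linepath)
    also have "norm (d (x \<tau>) \<tau>) \<le> dbar" using dbar_le \<tau> by simp
    finally show ?thesis by (simp add: algebra_simps)
  qed
  have dxd: "(xd has_vector_derivative g \<tau> (xd \<tau>)) (at \<tau> within {0..T})" if \<tau>: "\<tau> \<in> {0..T}" for \<tau>
  proof -
    have "0 \<le> \<tau>" using \<tau> by simp
    with target have *: "(xd has_vector_derivative h (xd \<tau>) (ud \<tau>) \<tau>) (at \<tau> within {0..})"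
      and ud: "ud \<tau> = us (xd \<tau>) (xd \<tau>) (ud \<tau>) \<tau>" unfolding target_trajectory_def by blast+
    have "g \<tau> (xd \<tau>) = h (xd \<tau>) (ud \<tau>) \<tau>" unfolding g_def by (simp flip: ud)
    with * show ?thesis by (auto intro: has_vector_derivative_within_subset)
  qed
  have dx: "(x has_vector_derivative g \<tau> (x \<tau>) + v \<tau>) (at \<tau> within {0..T})" if "\<tau> \<in> {0..T}" for \<tau>
    using closed_loop[OF that] by (simp add: v_def h_def ctrl_affine_def add.assoc)
  obtain R where R: "\<And>y. y \<in> Sx \<Longrightarrow> norm y \<le> R"
    using compact_imp_bounded[OF S_compact(1)] unfolding bounded_iff by blast
  define D where "D = (\<lambda>t. geodesic_dist (\<lambda>y. \<Theta> y t) (xd t) (x t))"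
  have D_lower: "norm (x t - xd t) \<le> D t / c" if "t \<in> {0..T}" for t
    using metric_factor.geodesic_dist_lower[OF mf, of t "x t" "xd t"] that c
    by (simp add: D_def field_simps)
  \<comment> \<open>Both trajectories stay in the compact set \<open>Sx\<close>; this supplies the
    boundedness required by the Gronwall lemma.\<close>
  have D_abs: "\<bar>D t\<bar> \<le> C * (R + R)" if t: "t \<in> {0..T}" for t
  proof -
    have "0 \<le> D t / c" using order_trans[OF norm_ge_zero D_lower[OF t]] .
    then have "0 \<le> D t" using c by (simp add: zero_le_divide_iff)
    moreover have "D t \<le> C * norm (x t - xd t)"
      using metric_factor.geodesic_dist_upper[OF mf] t by (simp add: D_def)
    moreover have "norm (x t - xd t) \<le> R + R"
      using R[OF mem(1)[OF t]] R[OF mem(2)[OF t]] by (intro norm_triangle_le_diff) simp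
    then have "C * norm (x t - xd t) \<le> C * (R + R)" using C by (intro mult_left_mono) auto
    ultimately show ?thesis by linarith
  qed
  \<comment> \<open>The part of the disturbance proportional to \<open>norm (x - xd)\<close> is
    bounded through \<open>D / c\<close>, which changes the rate from \<open>\<alpha>\<close> to
    \<open>\<alpha>l\<close>.\<close>
  have straddle: "\<exists>\<delta>>0. \<forall>a\<in>{0..T}. \<forall>b\<in>{0..T}. a \<le> \<tau> \<longrightarrow> \<tau> \<le> b \<longrightarrow> b - a < \<delta> \<longrightarrow>
      D b \<le> D a + (b - a) * (C * (Lu * \<epsilon>0 + dbar) - \<alpha>l * D a) + e * (b - a)"
    if \<tau>: "\<tau> \<in> {0..T}" and e: "0 < e" for \<tau> e
  proof -
    \<comment> \<open>\<open>e'\<close> limits the change of \<open>norm (x - xd)\<close> between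
      \<open>a\<close> and \<open>\<tau>\<close>, so that its contribution is at most
      \<open>e / 2\<close>; the summand 1 keeps \<open>r\<close> positive even if the coefficient is
      zero.\<close>
    define r where "r = C * (Lu * \<epsilon>1) + 1"
    define e' where "e' = e / (2 * r)"
    have pos: "0 < r" using C Lu_nonneg \<epsilon>1 by (simp add: r_def add_nonneg_pos)
    have e': "0 < e'" using e pos by (simp add: e'_def)
    have e'_le: "C * (Lu * \<epsilon>1) * e' \<le> e / 2"
    proof -
      have "C * (Lu * \<epsilon>1) * e' \<le> r * e'" using e' by (simp add: r_def)
      also have "\<dots> = e / 2" using pos by (simp add: e'_def)
      finally show ?thesis .
    qed
    have "0 < e / 2" using e by simp
    have DB: "geodesic_dist (\<lambda>y. \<Theta> y t) (xd t) (x t) \<le> C * (R + R)" if "t \<in> {0..T}" for t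
      using D_abs[OF that] by (simp add: D_def)
    have \<tau>0: "0 \<le> \<tau>" using \<tau> by simp
    obtain \<delta>1 where \<delta>1: "0 < \<delta>1" "\<And>a b. a \<in> {0..T} \<Longrightarrow> b \<in> {0..T} \<Longrightarrow> a \<le> \<tau> \<Longrightarrow> \<tau> \<le> b \<Longrightarrow> b - a < \<delta>1 \<Longrightarrow>
        D b \<le> D a + (b - a) * (C * norm (v \<tau>) - \<alpha> * D a) + e / 2 * (b - a)"
      using geodesic_dist_straddle[OF contracting g[OF \<tau>0] g_def[THEN fun_cong] \<tau> \<open>0 < e / 2\<close> dxd[OF \<tau>] dx[OF \<tau>] R[OF mem(2)] DB]
      unfolding D_def C_def by blast
    have "continuous (at \<tau> within {0..T}) (\<lambda>t. norm (x t - xd t))"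
      by (intro continuous_norm continuous_diff has_vector_derivative_continuous[OF dx[OF \<tau>]]
          has_vector_derivative_continuous[OF dxd[OF \<tau>]])
    then obtain \<delta>2 where \<delta>2: "0 < \<delta>2" "\<And>a. a \<in> {0..T} \<Longrightarrow> dist a \<tau> < \<delta>2 \<Longrightarrow>
        dist (norm (x a - xd a)) (norm (x \<tau> - xd \<tau>)) < e'"
      unfolding continuous_within_eps_delta using e' by blast
    show ?thesis
    proof (intro exI[of _ "min \<delta>1 \<delta>2"] conjI ballI impI)
      show "0 < min \<delta>1 \<delta>2" using \<delta>1 \<delta>2 by simp
      fix a b assume a: "a \<in> {0..T}" and b: "b \<in> {0..T}" and ab: "a \<le> \<tau>" "\<tau> \<le> b" "b - a < min \<delta>1 \<delta>2"
      \<comment> \<open>\<open>v\<close> is evaluated at \<open>\<tau>\<close>, but the inequality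
        must contain \<open>D a\<close>.\<close>
      have "norm (x \<tau> - xd \<tau>) \<le> norm (x a - xd a) + e'"
        using \<delta>2(2)[OF a] ab by (auto simp: dist_real_def)
      also have "\<dots> \<le> D a / c + e'" using D_lower[OF a] by simp
      finally have "C * (Lu * \<epsilon>1) * norm (x \<tau> - xd \<tau>) \<le> C * (Lu * \<epsilon>1) * (D a / c + e')"
        using C Lu_nonneg \<epsilon>1 by (intro mult_left_mono) auto
      moreover have "C * norm (v \<tau>) \<le> C * (Lu * \<epsilon>0 + dbar + Lu * \<epsilon>1 * norm (x \<tau> - xd \<tau>))"
        using v[OF \<tau>] C by (intro mult_left_mono) auto
      moreover have "C * (Lu * \<epsilon>1) * (D a / c + e') = (\<alpha> - \<alpha>l) * D a + C * (Lu * \<epsilon>1) * e'"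
        by (simp add: \<alpha>l C_def c_def real_sqrt_divide algebra_simps)
      ultimately have "C * norm (v \<tau>) - \<alpha> * D a \<le> C * (Lu * \<epsilon>0 + dbar) - \<alpha>l * D a + e / 2"
        using e'_le by (simp add: algebra_simps)
      then have "(b - a) * (C * norm (v \<tau>) - \<alpha> * D a) \<le> (b - a) * (C * (Lu * \<epsilon>0 + dbar) - \<alpha>l * D a + e / 2)"
        using ab by (intro mult_left_mono) auto
      moreover have "D b \<le> D a + (b - a) * (C * norm (v \<tau>) - \<alpha> * D a) + e / 2 * (b - a)"
        using ab by (intro \<delta>1(2) a b) auto
      ultimately show "D b \<le> D a + (b - a) * (C * (Lu * \<epsilon>0 + dbar) - \<alpha>l * D a) + e * (b - a)"
        by (simp add: field_simps)
    qed
  qed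
  \<comment> \<open>The virtual curve at time 0 is one of the competitors in the infimum.\<close>
  have D0: "D 0 \<le> norm (V_ell \<Theta> q 0)"
  proof -
    have "C1_path (\<lambda>\<mu>. q \<mu> 0) (xd 0) (x 0)"
      using virtual T_nonneg unfolding virtual_family_def by simp
    from metric_factor.geodesic_dist_le[OF mf this] have "D 0 \<le> V_ell \<Theta> q 0"
      by (simp add: D_def V_ell_def)
    then show ?thesis by simp
  qed
  show ?thesis
  proof
    fix t assume t: "t \<in> {0..T}"
    have "D t \<le> D 0 * exp (- \<alpha>l * t) + C * (Lu * \<epsilon>0 + dbar) / \<alpha>l * (1 - exp (- \<alpha>l * t))"
      using \<alpha>l_nonzero D_abs straddle t by (rule straddle_gronwall)
    also have "\<dots> \<le> norm (V_ell \<Theta> q 0) * exp (- \<alpha>l * t)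
        + C * (Lu * \<epsilon>0 + dbar) / \<alpha>l * (1 - exp (- \<alpha>l * t))"
      by (intro add_right_mono mult_right_mono D0) simp
    finally have "D t / c \<le> (norm (V_ell \<Theta> q 0) * exp (- \<alpha>l * t)
        + C * (Lu * \<epsilon>0 + dbar) / \<alpha>l * (1 - exp (- \<alpha>l * t))) / c"
      using c by (intro divide_right_mono) auto
    also have "\<dots> = norm (V_ell \<Theta> q 0) / sqrt mlow * exp (- \<alpha>l * t)
        + (Lu * \<epsilon>0 + dbar) / \<alpha>l * sqrt (mup / mlow) * (1 - exp (- \<alpha>l * t))"
    proof -
      have "(V * r + C * X / \<alpha>l * w) / c = V / c * r + X / \<alpha>l * (C / c) * w" for V r X w
        by (simp add: add_divide_distrib)
      then show ?thesis by (simp add: c_def C_def real_sqrt_divide)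
    qed
    finally show "norm (x t - xd t) \<le> norm (V_ell \<Theta> q 0) / sqrt mlow * exp (- \<alpha>l * t)
        + (Lu * \<epsilon>0 + dbar) / \<alpha>l * sqrt (mup / mlow) * (1 - exp (- \<alpha>l * t))"
      using D_lower[OF t] by linarith
  qed
qed

end
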